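(* Let $0<T_1<T_2\le T$ and let $\Omega_0\subset\Omega$ be a subdomain. Let $u_0\in H_0^1(\Omega)\cap H^2(\Omega)$ and $g(t)=e^{-\gamma t}$ with $\gamma\in\mathbb C$, $\gamma\notin\bigcup_{n\in\mathbb N\setminus\{0\}}\{a\lambda_n+ib\lambda_n\}$. For $j=1,2$ let $f_j\in L^2(\Omega)$ and let $u_j\in H^1(0,T;L^2(\Omega))\cap L^2(0,T;H_0^1(\Omega)\cap H^2(\Omega))$ be the solution of $$\begin{cases} \partial_t u_j-(a+ib)\Delta u_j=g(t)f_j(x), & (x,t)\in\Omega\times(0,T],\\ u_j(x,t)=0, & (x,t)\in\partial\Omega\times(0,T],\\ u_j(x,0)=u_0(x), & x\in\Omega,\end{cases}$$ with corresponding data $u_j(x,T_1)$, $u_j(x,T_2)$, $x\in\Omega_0$. Then $$\|f_1-f_2\|_{\mathcal B}\le\sum_{j=1}^2\|u_1(\cdot,T_j)-u_2(\cdot,T_j)\|_{L^2(\Omega_0)}.$$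
   Context: Here $a,b\in\mathbb R$ with $a>0$, $b\ne0$; $\Omega\subset\mathbb R^d$, $d\ge1$, is a bounded domain whose boundary $\partial\Omega$ is an analytic hypersurface. A subdomain is a nonempty open connected subset. Functions are complex-valued. $\{\lambda_n,\varphi_n\}_{n\ge1}$ is the Dirichlet eigensystem of $-\Delta$ on $\Omega$, $0<\lambda_1\le\lambda_2\le\cdots$. For $f\in L^2(\Omega)$ define $$\|f\|_{\mathcal B}:=\sup_{\substack{\varphi_j\in C_0^\infty(\Omega_0),\ j=1,2\\ \|\varphi_j\|_{L^2(\Omega_0)}=1}}\ \sum_{j=1}^2\left|\int_\Omega\int_0^{T_j}g(t)v_j(x,t)f(x)\,\mathrm dt\,\mathrm dx\right|,$$ where (in this definition the test functions $\varphi_j$ are not the eigenfunctions), $\varphi_j$ being extended by zero to $\Omega$, $v_j$ is the solution of the dual (backward) problem $$\begin{cases}\partial_t v_j+(a+ib)\Delta v_j=0 & \text{in }\Omega\times(0,T_j),\\ v_j=0 & \text{on }\partial\Omega\times(0,T_j),\\ v_j(x,T_j)=\varphi_j(x) & \text{in }\Omega.\end{cases}$$ *)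

theory Defs
  imports "HOL-Analysis.Analysis"
begin

text \<open>
  Elements of function spaces are represented by functions defined everywhere; only their values
  on the domain in question matter, up to null sets. A function of time and space is written
  in curried form, time first: \<open>u t x\<close>.
\<close>

section \<open>Domains with analytic boundary\<close>

definition bounded_domain :: "'a::euclidean_space set \<Rightarrow> bool" where
  "bounded_domain \<Omega> \<longleftrightarrow> \<Omega> \<noteq> {} \<and> open \<Omega> \<and> connected \<Omega> \<and> bounded \<Omega>"

definition subdomain :: "'a::euclidean_space set \<Rightarrow> 'a set \<Rightarrow> bool" where
  "subdomain \<Omega>0 \<Omega> \<longleftrightarrow> \<Omega>0 \<noteq> {} \<and> open \<Omega>0 \<and> connected \<Omega>0 \<and> \<Omega>0 \<subseteq> \<Omega>"

definition real_analytic_on :: "('a::euclidean_space \<Rightarrow> real) \<Rightarrow> 'a set \<Rightarrow> bool" where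
  "real_analytic_on \<rho> U \<longleftrightarrow>
     (\<forall>p\<in>U. \<exists>r>0. \<exists>c :: ('a \<Rightarrow> nat) \<Rightarrow> real. \<forall>x\<in>ball p r.
        ((\<lambda>\<alpha>. c \<alpha> * (\<Prod>i\<in>Basis. ((x - p) \<bullet> i) ^ \<alpha> i)) has_sum \<rho> x) (PiE Basis (\<lambda>_. UNIV)))"

text \<open>A level set of a real-analytic function with nonvanishing differential, locally.\<close>

definition analytic_hypersurface :: "'a::euclidean_space set \<Rightarrow> bool" where
  "analytic_hypersurface S \<longleftrightarrow>
     (\<forall>p\<in>S. \<exists>U \<rho>. open U \<and> p \<in> U \<and> real_analytic_on \<rho> U \<and>
        (\<forall>x\<in>U. frechet_derivative \<rho> (at x) \<noteq> (\<lambda>_. 0)) \<and> S \<inter> U = {x \<in> U. \<rho> x = 0})"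

section \<open>Test functions, Lebesgue and Sobolev spaces\<close>

definition partial_deriv :: "'a::euclidean_space \<Rightarrow> ('a \<Rightarrow> complex) \<Rightarrow> 'a \<Rightarrow> complex" where
  "partial_deriv i f x = frechet_derivative f (at x) i"

primrec C_k :: "nat \<Rightarrow> ('a::euclidean_space \<Rightarrow> complex) \<Rightarrow> bool" where
  "C_k 0 f \<longleftrightarrow> continuous_on UNIV f"
| "C_k (Suc k) f \<longleftrightarrow> (\<forall>x. f differentiable at x) \<and> (\<forall>i\<in>Basis. C_k k (partial_deriv i f))"

text \<open>Smooth functions with compact support in \<open>\<Omega>\<close>, already extended by zero to the whole space.\<close>

definition test_functions :: "'a::euclidean_space set \<Rightarrow> ('a \<Rightarrow> complex) set" where
  "test_functions \<Omega> =
     {\<phi>. (\<forall>k. C_k k \<phi>) \<and> compact (closure {x. \<phi> x \<noteq> 0}) \<and> closure {x. \<phi> x \<noteq> 0} \<subseteq> \<Omega>}"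

definition L2_space :: "'a::euclidean_space set \<Rightarrow> ('a \<Rightarrow> complex) set" where
  "L2_space \<Omega> = {f. f \<in> borel_measurable (lebesgue_on \<Omega>) \<and>
                    integrable (lebesgue_on \<Omega>) (\<lambda>x. (cmod (f x))\<^sup>2)}"

definition L2_norm :: "'a::euclidean_space set \<Rightarrow> ('a \<Rightarrow> complex) \<Rightarrow> real" where
  "L2_norm \<Omega> f = sqrt (\<integral>x. (cmod (f x))\<^sup>2 \<partial>lebesgue_on \<Omega>)"

definition L2_inner :: "'a::euclidean_space set \<Rightarrow> ('a \<Rightarrow> complex) \<Rightarrow> ('a \<Rightarrow> complex) \<Rightarrow> complex" where
  "L2_inner \<Omega> f h = (\<integral>x. f x * cnj (h x) \<partial>lebesgue_on \<Omega>)"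

definition is_weak_deriv ::
    "'a::euclidean_space set \<Rightarrow> 'a \<Rightarrow> ('a \<Rightarrow> complex) \<Rightarrow> ('a \<Rightarrow> complex) \<Rightarrow> bool" where
  "is_weak_deriv \<Omega> i f h \<longleftrightarrow> f \<in> L2_space \<Omega> \<and> h \<in> L2_space \<Omega> \<and>
     (\<forall>\<phi>\<in>test_functions \<Omega>.
        (\<integral>x. f x * partial_deriv i \<phi> x \<partial>lebesgue_on \<Omega>) = - (\<integral>x. h x * \<phi> x \<partial>lebesgue_on \<Omega>))"

text \<open>Weak derivatives are unique up to null sets, so the choice of representative is immaterial.\<close>

definition weak_deriv :: "'a::euclidean_space set \<Rightarrow> 'a \<Rightarrow> ('a \<Rightarrow> complex) \<Rightarrow> 'a \<Rightarrow> complex" where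
  "weak_deriv \<Omega> i f = (SOME h. is_weak_deriv \<Omega> i f h)"

definition H1_space :: "'a::euclidean_space set \<Rightarrow> ('a \<Rightarrow> complex) set" where
  "H1_space \<Omega> = {f \<in> L2_space \<Omega>. \<forall>i\<in>Basis. \<exists>h. is_weak_deriv \<Omega> i f h}"

definition H2_space :: "'a::euclidean_space set \<Rightarrow> ('a \<Rightarrow> complex) set" where
  "H2_space \<Omega> = {f \<in> H1_space \<Omega>. \<forall>i\<in>Basis. weak_deriv \<Omega> i f \<in> H1_space \<Omega>}"

definition H1_norm :: "'a::euclidean_space set \<Rightarrow> ('a \<Rightarrow> complex) \<Rightarrow> real" where
  "H1_norm \<Omega> f = sqrt ((L2_norm \<Omega> f)\<^sup>2 + (\<Sum>i\<in>Basis. (L2_norm \<Omega> (weak_deriv \<Omega> i f))\<^sup>2))"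

definition H2_norm :: "'a::euclidean_space set \<Rightarrow> ('a \<Rightarrow> complex) \<Rightarrow> real" where
  "H2_norm \<Omega> f = sqrt ((H1_norm \<Omega> f)\<^sup>2 +
     (\<Sum>i\<in>Basis. \<Sum>j\<in>Basis. (L2_norm \<Omega> (weak_deriv \<Omega> j (weak_deriv \<Omega> i f)))\<^sup>2))"

definition H10_space :: "'a::euclidean_space set \<Rightarrow> ('a \<Rightarrow> complex) set" where
  "H10_space \<Omega> = {f \<in> H1_space \<Omega>. \<exists>\<phi>. (\<forall>n. \<phi> n \<in> test_functions \<Omega>) \<and>
                     (\<lambda>n::nat. H1_norm \<Omega> (\<lambda>x. f x - \<phi> n x)) \<longlonglongrightarrow> 0}"

definition laplacian :: "'a::euclidean_space set \<Rightarrow> ('a \<Rightarrow> complex) \<Rightarrow> 'a \<Rightarrow> complex" where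
  "laplacian \<Omega> f x = (\<Sum>i\<in>Basis. weak_deriv \<Omega> i (weak_deriv \<Omega> i f) x)"

text \<open>
  Indices start at 1. Completeness of the orthonormal system \<open>e\<close> forces every eigenvalue to be
  listed with its full multiplicity.
\<close>

definition dirichlet_eigensystem ::
    "'a::euclidean_space set \<Rightarrow> (nat \<Rightarrow> real) \<Rightarrow> (nat \<Rightarrow> 'a \<Rightarrow> complex) \<Rightarrow> bool" where
  "dirichlet_eigensystem \<Omega> ev e \<longleftrightarrow>
     (\<forall>n\<ge>1. 0 < ev n \<and> ev n \<le> ev (Suc n) \<and> e n \<in> H10_space \<Omega> \<inter> H2_space \<Omega> \<and>
        (AE x in lebesgue_on \<Omega>. - laplacian \<Omega> (e n) x = of_real (ev n) * e n x)) \<and>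
     (\<forall>m\<ge>1. \<forall>n\<ge>1. L2_inner \<Omega> (e m) (e n) = (if m = n then 1 else 0)) \<and>
     (\<forall>f\<in>L2_space \<Omega>. (\<forall>n\<ge>1. L2_inner \<Omega> f (e n) = 0) \<longrightarrow> (AE x in lebesgue_on \<Omega>. f x = 0))"

section \<open>Bochner spaces over a time interval\<close>

text \<open>
  Strong measurability, on \<open>I\<close>, of a function with values in the space \<open>X\<close> normed by \<open>N\<close>:
  almost everywhere limit of simple functions.
\<close>

definition strongly_measurable_on ::
    "real set \<Rightarrow> ('a \<Rightarrow> complex) set \<Rightarrow> (('a \<Rightarrow> complex) \<Rightarrow> real) \<Rightarrow> (real \<Rightarrow> 'a \<Rightarrow> complex) \<Rightarrow> bool"
  where
  "strongly_measurable_on I X N u \<longleftrightarrow>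
     (\<exists>s :: nat \<Rightarrow> real \<Rightarrow> 'a \<Rightarrow> complex.
        (\<forall>n. s n ` I \<subseteq> X \<and> finite (s n ` I) \<and> (\<forall>h. {t \<in> I. s n t = h} \<in> sets lebesgue)) \<and>
        (AE t in lebesgue_on I. (\<lambda>n. N (\<lambda>x. s n t x - u t x)) \<longlonglongrightarrow> 0))"

text \<open>
  The space \<open>L\<^sup>2(0,T;X)\<close> for a space \<open>X\<close> of functions on \<open>\<Omega>\<close> with norm \<open>N\<close>. Every class has
  a representative that is jointly measurable in time and space, and only those are admitted:
  otherwise iterated integrals with the time integral inside would not be determined by the class.
\<close>

definition L2_time ::
    "real \<Rightarrow> 'a::euclidean_space set \<Rightarrow> ('a \<Rightarrow> complex) set \<Rightarrow> (('a \<Rightarrow> complex) \<Rightarrow> real) \<Rightarrow>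
     (real \<Rightarrow> 'a \<Rightarrow> complex) set" where
  "L2_time T \<Omega> X N =
     {u. (\<lambda>(t, x). u t x) \<in> borel_measurable (lebesgue_on {0<..<T} \<Otimes>\<^sub>M lebesgue_on \<Omega>) \<and>
         (AE t in lebesgue_on {0<..<T}. u t \<in> X) \<and>
         strongly_measurable_on {0<..<T} X N u \<and>
         integrable (lebesgue_on {0<..<T}) (\<lambda>t. (N (u t))\<^sup>2)}"

text \<open>
  Weak time derivative in \<open>L\<^sup>2(0,T;L\<^sup>2(\<Omega>))\<close>. For jointly measurable functions an
  \<open>L\<^sup>2(\<Omega>)\<close>-valued Bochner integral over \<open>(0,T)\<close> is given by the scalar integral at almost every
  point of \<open>\<Omega>\<close>.
\<close>

definition is_time_deriv ::
    "real \<Rightarrow> 'a::euclidean_space set \<Rightarrow> (real \<Rightarrow> 'a \<Rightarrow> complex) \<Rightarrow> (real \<Rightarrow> 'a \<Rightarrow> complex) \<Rightarrow> bool"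
  where
  "is_time_deriv T \<Omega> u w \<longleftrightarrow>
     u \<in> L2_time T \<Omega> (L2_space \<Omega>) (L2_norm \<Omega>) \<and> w \<in> L2_time T \<Omega> (L2_space \<Omega>) (L2_norm \<Omega>) \<and>
     (\<forall>\<psi>\<in>test_functions {0<..<T}. AE x in lebesgue_on \<Omega>.
        (\<integral>t. partial_deriv 1 \<psi> t * u t x \<partial>lebesgue_on {0<..<T}) =
        - (\<integral>t. \<psi> t * w t x \<partial>lebesgue_on {0<..<T}))"

definition time_deriv ::
    "real \<Rightarrow> 'a::euclidean_space set \<Rightarrow> (real \<Rightarrow> 'a \<Rightarrow> complex) \<Rightarrow> real \<Rightarrow> 'a \<Rightarrow> complex" where
  "time_deriv T \<Omega> u = (SOME w. is_time_deriv T \<Omega> u w)"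

definition H1_time :: "real \<Rightarrow> 'a::euclidean_space set \<Rightarrow> (real \<Rightarrow> 'a \<Rightarrow> complex) set" where
  "H1_time T \<Omega> = {u \<in> L2_time T \<Omega> (L2_space \<Omega>) (L2_norm \<Omega>). \<exists>w. is_time_deriv T \<Omega> u w}"

definition continuous_into_L2 ::
    "real \<Rightarrow> 'a::euclidean_space set \<Rightarrow> (real \<Rightarrow> 'a \<Rightarrow> complex) \<Rightarrow> bool" where
  "continuous_into_L2 T \<Omega> u \<longleftrightarrow>
     (\<forall>s\<in>{0..T}. u s \<in> L2_space \<Omega> \<and>
        ((\<lambda>t. L2_norm \<Omega> (\<lambda>x. u t x - u s x)) \<longlongrightarrow> 0) (at s within {0..T}))"

text \<open>
  The class \<open>H\<^sup>1(0,T;L\<^sup>2(\<Omega>)) \<inter> L\<^sup>2(0,T;H\<^sub>0\<^sup>1(\<Omega>) \<inter> H\<^sup>2(\<Omega>))\<close>. Its elements have a representative that is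
  continuous on \<open>[0,T]\<close> with values in \<open>L\<^sup>2(\<Omega>)\<close>; values at a fixed time refer to
  that representative, so continuity is part of the definition.
\<close>

definition solution_space :: "real \<Rightarrow> 'a::euclidean_space set \<Rightarrow> (real \<Rightarrow> 'a \<Rightarrow> complex) set" where
  "solution_space T \<Omega> =
     {u \<in> H1_time T \<Omega> \<inter> L2_time T \<Omega> (H10_space \<Omega> \<inter> H2_space \<Omega>) (H2_norm \<Omega>).
        continuous_into_L2 T \<Omega> u}"

section \<open>Forward problem, dual problem and the norm\<close>

text \<open>
  The equations hold in \<open>L\<^sup>2(\<Omega>)\<close> for almost every time. The homogeneous Dirichlet
  condition is the membership of \<open>u t\<close> in \<open>H10_space \<Omega>\<close>.
\<close>

definition forward_solution ::
    "real \<Rightarrow> real \<Rightarrow> 'a::euclidean_space set \<Rightarrow> real \<Rightarrow> (real \<Rightarrow> complex) \<Rightarrow> ('a \<Rightarrow> complex) \<Rightarrow>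
     ('a \<Rightarrow> complex) \<Rightarrow> (real \<Rightarrow> 'a \<Rightarrow> complex) \<Rightarrow> bool" where
  "forward_solution a b \<Omega> T g f u0 u \<longleftrightarrow> u \<in> solution_space T \<Omega> \<and>
     (AE t in lebesgue_on {0<..<T}. AE x in lebesgue_on \<Omega>.
        time_deriv T \<Omega> u t x - (of_real a + \<i> * of_real b) * laplacian \<Omega> (u t) x = g t * f x) \<and>
     (AE x in lebesgue_on \<Omega>. u 0 x = u0 x)"

definition dual_solution ::
    "real \<Rightarrow> real \<Rightarrow> 'a::euclidean_space set \<Rightarrow> real \<Rightarrow> ('a \<Rightarrow> complex) \<Rightarrow>
     (real \<Rightarrow> 'a \<Rightarrow> complex) \<Rightarrow> bool" where
  "dual_solution a b \<Omega> T \<phi> v \<longleftrightarrow> v \<in> solution_space T \<Omega> \<and>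
     (AE t in lebesgue_on {0<..<T}. AE x in lebesgue_on \<Omega>.
        time_deriv T \<Omega> v t x + (of_real a + \<i> * of_real b) * laplacian \<Omega> (v t) x = 0) \<and>
     (AE x in lebesgue_on \<Omega>. v T x = \<phi> x)"

text \<open>
  The supremum is taken in \<open>[0,\<infinity>]\<close>, over all admissible \<open>\<phi>\<close> together with the
  corresponding dual solutions \<open>v\<close>, which are unique up to null sets.
\<close>

definition B_norm ::
    "real \<Rightarrow> real \<Rightarrow> (real \<Rightarrow> complex) \<Rightarrow> 'a::euclidean_space set \<Rightarrow> 'a set \<Rightarrow> (nat \<Rightarrow> real) \<Rightarrow>
     ('a \<Rightarrow> complex) \<Rightarrow> ennreal" where
  "B_norm a b g \<Omega> \<Omega>0 \<tau> f =
     (SUP (\<phi>, v) \<in> {(\<phi>, v). \<forall>j\<in>{1..2}. \<phi> j \<in> test_functions \<Omega>0 \<and> L2_norm \<Omega>0 (\<phi> j) = 1 \<and>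
                                     dual_solution a b \<Omega> (\<tau> j) (\<phi> j) (v j)}.
        ennreal (\<Sum>j=1..2. cmod (\<integral>x. (\<integral>t. g t * v j t x * f x \<partial>lebesgue_on {0<..<\<tau> j})
                                   \<partial>lebesgue_on \<Omega>)))"

end

(*
  Multiply the forward equation by the dual solution v and integrate over the domain: since the
  Dirichlet Laplacian is symmetric for the bilinear pairing, the Laplacian terms cancel and
  d/dt <u(t), v(t)> = g(t) <f, v(t)>. Integrating over (0, T_j), the initial value u_0 drops out of
  the difference of the two solutions, so the integral in the definition of the norm equals
  <u_1(T_j) - u_2(T_j), phi_j>, and Cauchy-Schwarz on Omega_0 gives the bound.
*)

theory Submission
  imports Defs
begin


section \<open>Square-integrable functions\<close>

text \<open>The equations hold only for almost every time and their time derivatives are weak, so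
  the product rule behind the derivative of the pairing of \<open>u t\<close> with
  \<open>v t\<close> is the real obstacle. Pairing with one fixed square-integrable function turns a
  weak time derivative into a scalar one, and a continuous scalar function is recovered from an
  integrable weak derivative by integration. This controls the increment of the pairing with one
  factor frozen; freezing costs an error that is small on short intervals by continuity into L2, and
  these errors sum to an arbitrarily small total. The symmetry of the Laplacian meets a second
  obstacle: \<open>weak_deriv\<close> is a choice, and comparing choices needs uniqueness of weak
  derivatives. It comes from completeness of the eigenfunctions, which are limits of test functions.
  The pairing carries no conjugate because the same complex coefficient a + ib stands in both
  equations; with a conjugate the Laplacian terms would leave a multiple of 2ib.\<close>

lemma
  fixes f h :: "'a \<Rightarrow> complex"
  assumes [measurable]: "f \<in> borel_measurable M" "h \<in> borel_measurable M"
    and f: "integrable M (\<lambda>x. (cmod (f x))\<^sup>2)" and h: "integrable M (\<lambda>x. (cmod (h x))\<^sup>2)"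
  shows integrable_mult_square_integrable: "integrable M (\<lambda>x. f x * h x)"
    and Cauchy_Schwarz_integral:
      "cmod (\<integral>x. f x * h x \<partial>M) \<le> sqrt (\<integral>x. (cmod (f x))\<^sup>2 \<partial>M) * sqrt (\<integral>x. (cmod (h x))\<^sup>2 \<partial>M)"
proof -
  show int: "integrable M (\<lambda>x. f x * h x)"
  proof (rule Bochner_Integration.integrable_bound)
    show "integrable M (\<lambda>x. (cmod (f x))\<^sup>2 + (cmod (h x))\<^sup>2)"
      using f h by simp
    show "AE x in M. cmod (f x * h x) \<le> norm ((cmod (f x))\<^sup>2 + (cmod (h x))\<^sup>2)"
    proof (rule AE_I2)
      fix x
      have "cmod (f x) * cmod (h x) \<le> 2 * cmod (f x) * cmod (h x)"
        by simp
      also have "\<dots> \<le> (cmod (f x))\<^sup>2 + (cmod (h x))\<^sup>2"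
        by (rule sum_squares_bound)
      finally show "cmod (f x * h x) \<le> norm ((cmod (f x))\<^sup>2 + (cmod (h x))\<^sup>2)"
        by (simp add: norm_mult)
    qed
  qed simp
  \<comment> \<open>The inequality is taken from the extended nonnegative integral; finiteness of
    the two square integrals carries it back to the reals.\<close>
  have "ennreal ((\<integral>x. cmod (f x * h x) \<partial>M)\<^sup>2) = (\<integral>\<^sup>+x. ennreal (cmod (f x)) * ennreal (cmod (h x)) \<partial>M)\<^sup>2"
    using nn_integral_eq_integral[OF integrable_norm[OF int]]
    by (simp add: ennreal_power[symmetric] norm_mult ennreal_mult)
  also have "\<dots> \<le> (\<integral>\<^sup>+x. ennreal (cmod (f x))^2 \<partial>M) * (\<integral>\<^sup>+x. ennreal (cmod (h x))^2 \<partial>M)"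
    by (rule Cauchy_Schwarz_nn_integral) simp_all
  also have "\<dots> = ennreal ((\<integral>x. (cmod (f x))\<^sup>2 \<partial>M) * (\<integral>x. (cmod (h x))\<^sup>2 \<partial>M))"
    using f h by (simp add: ennreal_power nn_integral_eq_integral ennreal_mult)
  finally have "(\<integral>x. cmod (f x * h x) \<partial>M)\<^sup>2 \<le> (\<integral>x. (cmod (f x))\<^sup>2 \<partial>M) * (\<integral>x. (cmod (h x))\<^sup>2 \<partial>M)"
    by (subst (asm) ennreal_le_iff) simp_all
  then have "(\<integral>x. cmod (f x * h x) \<partial>M) \<le> sqrt ((\<integral>x. (cmod (f x))\<^sup>2 \<partial>M) * (\<integral>x. (cmod (h x))\<^sup>2 \<partial>M))"
    by (rule real_le_rsqrt)
  then show "cmod (\<integral>x. f x * h x \<partial>M) \<le> sqrt (\<integral>x. (cmod (f x))\<^sup>2 \<partial>M) * sqrt (\<integral>x. (cmod (h x))\<^sup>2 \<partial>M)"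
    unfolding real_sqrt_mult by (rule order_trans[OF integral_norm_bound])
qed

lemma L2_spaceD:
  assumes "f \<in> L2_space \<Omega>"
  shows "f \<in> borel_measurable (lebesgue_on \<Omega>)" "integrable (lebesgue_on \<Omega>) (\<lambda>x. (cmod (f x))\<^sup>2)"
  using assms by (auto simp: L2_space_def)

lemma L2_integrable_mult:
  "f \<in> L2_space \<Omega> \<Longrightarrow> h \<in> L2_space \<Omega> \<Longrightarrow> integrable (lebesgue_on \<Omega>) (\<lambda>x. f x * h x)"
  by (intro integrable_mult_square_integrable L2_spaceD)

lemma L2_Cauchy_Schwarz:
  "f \<in> L2_space \<Omega> \<Longrightarrow> h \<in> L2_space \<Omega> \<Longrightarrow>
    cmod (\<integral>x. f x * h x \<partial>lebesgue_on \<Omega>) \<le> L2_norm \<Omega> f * L2_norm \<Omega> h"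
  unfolding L2_norm_def by (intro Cauchy_Schwarz_integral L2_spaceD)

lemma L2_norm_nonneg [simp]: "0 \<le> L2_norm \<Omega> f"
  by (simp add: L2_norm_def)

lemma L2_norm_minus_commute: "L2_norm \<Omega> (\<lambda>x. f x - h x) = L2_norm \<Omega> (\<lambda>x. h x - f x)"
  by (simp add: L2_norm_def norm_minus_commute)

lemma L2_space_diff:
  assumes f: "f \<in> L2_space \<Omega>" and h: "h \<in> L2_space \<Omega>"
  shows "(\<lambda>x. f x - h x) \<in> L2_space \<Omega>"
proof -
  note [measurable] = L2_spaceD(1)[OF f] L2_spaceD(1)[OF h]
  have "integrable (lebesgue_on \<Omega>) (\<lambda>x. (cmod (f x - h x))\<^sup>2)"
  proof (rule Bochner_Integration.integrable_bound)
    show "integrable (lebesgue_on \<Omega>) (\<lambda>x. 2 * (cmod (f x))\<^sup>2 + 2 * (cmod (h x))\<^sup>2)"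
      using L2_spaceD(2)[OF f] L2_spaceD(2)[OF h] by simp
    show "AE x in lebesgue_on \<Omega>.
        norm ((cmod (f x - h x))\<^sup>2) \<le> norm (2 * (cmod (f x))\<^sup>2 + 2 * (cmod (h x))\<^sup>2)"
    proof (rule AE_I2)
      fix x
      have "(cmod (f x - h x))\<^sup>2 \<le> (cmod (f x) + cmod (h x))\<^sup>2"
        by (intro power_mono norm_triangle_ineq4) simp
      also have "\<dots> \<le> 2 * (cmod (f x))\<^sup>2 + 2 * (cmod (h x))\<^sup>2"
        using sum_squares_bound[of "cmod (f x)" "cmod (h x)"] by (simp add: power2_sum)
      finally show "norm ((cmod (f x - h x))\<^sup>2) \<le> norm (2 * (cmod (f x))\<^sup>2 + 2 * (cmod (h x))\<^sup>2)"
        by simp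
    qed
  qed simp
  then show ?thesis
    by (simp add: L2_space_def)
qed

lemma L2_space_cnj: "f \<in> L2_space \<Omega> \<Longrightarrow> (\<lambda>x. cnj (f x)) \<in> L2_space \<Omega>"
  unfolding L2_space_def
  by (auto intro: borel_measurable_continuous_on[OF continuous_on_cnj[OF continuous_on_id], simplified])

lemma L2_norm_cnj [simp]: "L2_norm \<Omega> (\<lambda>x. cnj (f x)) = L2_norm \<Omega> f"
  by (simp add: L2_norm_def)

lemma integrable_lebesgue_on_subset:
  fixes f :: "'a::euclidean_space \<Rightarrow> 'b::{banach, second_countable_topology}"
  assumes f: "integrable (lebesgue_on T) f" and ST: "S \<subseteq> T" and "S \<in> sets lebesgue" "T \<in> sets lebesgue"
  shows "integrable (lebesgue_on S) f"
proof -
  have "integrable lebesgue (\<lambda>x. indicator S x *\<^sub>R (if x \<in> T then f x else 0))"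
    using assms by (intro integrable_mult_indicator) (simp_all add: Lebesgue_Measure.integrable_restrict_UNIV)
  also have "(\<lambda>x. indicator S x *\<^sub>R (if x \<in> T then f x else 0)) = (\<lambda>x. if x \<in> S then f x else 0)"
    using ST by (intro ext) (auto split: split_indicator)
  finally show ?thesis
    using assms by (simp add: Lebesgue_Measure.integrable_restrict_UNIV)
qed

lemma L2_space_subset:
  assumes "f \<in> L2_space \<Omega>" "S \<subseteq> \<Omega>" "S \<in> sets lebesgue" "\<Omega> \<in> sets lebesgue"
  shows "f \<in> L2_space S"
proof -
  have "integrable (lebesgue_on S) (\<lambda>x. (cmod (f x))\<^sup>2)"
    using L2_spaceD(2)[OF assms(1)] assms(2-4) by (rule integrable_lebesgue_on_subset)
  moreover have "f \<in> borel_measurable (lebesgue_on S)"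
    using L2_spaceD(1)[OF assms(1)] assms(2) by (rule measurable_restrict_mono)
  ultimately show ?thesis
    by (simp add: L2_space_def)
qed

lemma L2_pairing_diff_left:
  assumes "f \<in> L2_space \<Omega>" "h \<in> L2_space \<Omega>" "p \<in> L2_space \<Omega>"
  shows "(\<integral>x. (f x - h x) * p x \<partial>lebesgue_on \<Omega>) =
    (\<integral>x. f x * p x \<partial>lebesgue_on \<Omega>) - (\<integral>x. h x * p x \<partial>lebesgue_on \<Omega>)"
  using assms by (simp add: L2_integrable_mult left_diff_distrib)

lemma L2_pairing_diff_right:
  assumes "p \<in> L2_space \<Omega>" "f \<in> L2_space \<Omega>" "h \<in> L2_space \<Omega>"
  shows "(\<integral>x. p x * (f x - h x) \<partial>lebesgue_on \<Omega>) =
    (\<integral>x. p x * f x \<partial>lebesgue_on \<Omega>) - (\<integral>x. p x * h x \<partial>lebesgue_on \<Omega>)"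
  using assms by (simp add: L2_integrable_mult right_diff_distrib)

text \<open>By Cauchy-Schwarz, a pairing with a fixed square-integrable function is continuous for
  the L2 norm. Membership of \<open>h n\<close> is asked only eventually because one use has times
  near \<open>s\<close> inside \<open>{0..S}\<close> as its filter.\<close>

lemma L2_pairing_tendsto:
  assumes p: "p \<in> L2_space \<Omega>" and f: "f \<in> L2_space \<Omega>" and h: "\<forall>\<^sub>F n in F. h n \<in> L2_space \<Omega>"
    and lim: "((\<lambda>n. L2_norm \<Omega> (\<lambda>x. f x - h n x)) \<longlongrightarrow> 0) F"
  shows "((\<lambda>n. \<integral>x. p x * h n x \<partial>lebesgue_on \<Omega>) \<longlongrightarrow> (\<integral>x. p x * f x \<partial>lebesgue_on \<Omega>)) F"
proof (rule LIM_zero_cancel, rule Lim_null_comparison)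
  show "((\<lambda>n. L2_norm \<Omega> p * L2_norm \<Omega> (\<lambda>x. f x - h n x)) \<longlongrightarrow> 0) F"
    using tendsto_mult_right_zero[OF lim] .
  show "\<forall>\<^sub>F n in F. norm ((\<integral>x. p x * h n x \<partial>lebesgue_on \<Omega>) - (\<integral>x. p x * f x \<partial>lebesgue_on \<Omega>))
          \<le> L2_norm \<Omega> p * L2_norm \<Omega> (\<lambda>x. f x - h n x)"
    using h
  proof eventually_elim
    case (elim n)
    have "norm ((\<integral>x. p x * h n x \<partial>lebesgue_on \<Omega>) - (\<integral>x. p x * f x \<partial>lebesgue_on \<Omega>)) =
        norm (\<integral>x. p x * (f x - h n x) \<partial>lebesgue_on \<Omega>)"
      using p f elim by (simp add: L2_pairing_diff_right norm_minus_commute)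
    also have "\<dots> \<le> L2_norm \<Omega> p * L2_norm \<Omega> (\<lambda>x. f x - h n x)"
      using p f elim by (intro L2_Cauchy_Schwarz L2_space_diff)
    finally show ?case .
  qed
qed


section \<open>Test functions\<close>

lemma C_k_imp_continuous: "C_k k f \<Longrightarrow> continuous_on UNIV f"
  by (cases k) (auto intro!: differentiable_imp_continuous_on simp: differentiable_on_def
      intro: differentiable_at_withinI)

lemma C_k_Suc_imp_C_k: "C_k (Suc k) f \<Longrightarrow> C_k k f"
proof (induction k arbitrary: f)
  case 0
  then show ?case
    using C_k_imp_continuous by (metis C_k.simps(1))
next
  case (Suc k)
  then show ?case
    by (metis C_k.simps(2))
qed

lemma partial_deriv_eqI: "(f has_derivative f') (at x) \<Longrightarrow> partial_deriv i f x = f' i"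
  by (simp add: partial_deriv_def frechet_derivative_at[symmetric])

lemma partial_deriv_add:
  assumes "f differentiable at x" "h differentiable at x"
  shows "partial_deriv i (\<lambda>x. f x + h x) x = partial_deriv i f x + partial_deriv i h x"
  unfolding partial_deriv_def[of i f] partial_deriv_def[of i h]
  by (rule partial_deriv_eqI) (use assms in \<open>auto intro!: has_derivative_add simp: frechet_derivative_works[symmetric]\<close>)

lemma partial_deriv_mult:
  assumes "f differentiable at x" "h differentiable at x"
  shows "partial_deriv i (\<lambda>x. f x * h x) x = f x * partial_deriv i h x + partial_deriv i f x * h x"
  unfolding partial_deriv_def[of i f] partial_deriv_def[of i h]
  by (rule partial_deriv_eqI) (use assms in \<open>auto intro!: has_derivative_mult simp: frechet_derivative_works[symmetric]\<close>)

lemma has_derivative_cnj: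
  "(f has_derivative f') F \<Longrightarrow> ((\<lambda>x. cnj (f x)) has_derivative (\<lambda>x. cnj (f' x))) F"
  by (rule bounded_linear.has_derivative[OF bounded_linear_cnj])

lemma partial_deriv_cnj:
  assumes "f differentiable at x"
  shows "partial_deriv i (\<lambda>x. cnj (f x)) x = cnj (partial_deriv i f x)"
  unfolding partial_deriv_def[of i f]
  by (rule partial_deriv_eqI) (use assms in \<open>auto intro!: has_derivative_cnj simp: frechet_derivative_works[symmetric]\<close>)

lemma differentiable_cnj: "f differentiable F \<Longrightarrow> (\<lambda>x. cnj (f x)) differentiable F"
  unfolding differentiable_def using has_derivative_cnj by blast

lemma C_k_add: "C_k k f \<Longrightarrow> C_k k h \<Longrightarrow> C_k k (\<lambda>x. f x + h x)"
proof (induction k arbitrary: f h)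
  case 0
  then show ?case
    by (auto intro: continuous_on_add)
next
  case (Suc k)
  then have "partial_deriv i (\<lambda>x. f x + h x) = (\<lambda>x. partial_deriv i f x + partial_deriv i h x)" for i
    by (auto simp: partial_deriv_add)
  with Suc show ?case
    by auto
qed

lemma C_k_mult: "C_k k f \<Longrightarrow> C_k k h \<Longrightarrow> C_k k (\<lambda>x. f x * h x)"
proof (induction k arbitrary: f h)
  case 0
  then show ?case
    by (auto intro: continuous_on_mult)
next
  case (Suc k)
  then have "partial_deriv i (\<lambda>x. f x * h x) = (\<lambda>x. f x * partial_deriv i h x + partial_deriv i f x * h x)" for i
    by (auto simp: partial_deriv_mult)
  \<comment> \<open>Each summand of the product rule still holds an undifferentiated factor, which
    must first be lowered from order \<open>Suc k\<close> to \<open>k\<close>.\<close>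
  with Suc Suc.prems[THEN C_k_Suc_imp_C_k] show ?case
    by (auto intro!: C_k_add)
qed

lemma C_k_cnj: "C_k k f \<Longrightarrow> C_k k (\<lambda>x. cnj (f x))"
proof (induction k arbitrary: f)
  case 0
  then show ?case
    by (auto intro: continuous_on_cnj)
next
  case (Suc k)
  then have "partial_deriv i (\<lambda>x. cnj (f x)) = (\<lambda>x. cnj (partial_deriv i f x))" for i
    by (auto simp: partial_deriv_cnj)
  with Suc show ?case
    by (auto intro: differentiable_cnj)
qed

lemma test_functionsD:
  assumes "\<phi> \<in> test_functions \<Omega>"
  shows "C_k k \<phi>" "continuous_on UNIV \<phi>" "\<phi> differentiable at x" "x \<notin> \<Omega> \<Longrightarrow> \<phi> x = 0"
    "compact (closure {x. \<phi> x \<noteq> 0})"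
proof -
  show C: "C_k k \<phi>" for k
    using assms by (simp add: test_functions_def)
  then show "continuous_on UNIV \<phi>"
    by (rule C_k_imp_continuous)
  show "\<phi> differentiable at x"
    using C[of "Suc 0"] by simp
  show "\<phi> x = 0" if "x \<notin> \<Omega>"
    using assms closure_subset[of "{x. \<phi> x \<noteq> 0}"] that by (auto simp: test_functions_def)
  show "compact (closure {x. \<phi> x \<noteq> 0})"
    using assms by (simp add: test_functions_def)
qed

text \<open>Compactness of the support passes to any smaller closed set. This one criterion serves
  derivatives, products and conjugates of test functions.\<close>

lemma test_functionsI_support:
  assumes "\<phi> \<in> test_functions \<Omega>" and "\<And>k. C_k k \<psi>" and "\<And>x. \<psi> x \<noteq> 0 \<Longrightarrow> x \<in> closure {x. \<phi> x \<noteq> 0}"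
  shows "\<psi> \<in> test_functions \<Omega>"
proof -
  have "closure {x. \<psi> x \<noteq> 0} \<subseteq> closure {x. \<phi> x \<noteq> 0}"
    using assms(3) by (intro closure_minimal) auto
  moreover from this have "closure {x. \<psi> x \<noteq> 0} = closure {x. \<phi> x \<noteq> 0} \<inter> closure {x. \<psi> x \<noteq> 0}"
    by blast
  then have "compact (closure {x. \<psi> x \<noteq> 0})"
    using test_functionsD(5)[OF assms(1)] by (metis closed_closure compact_Int_closed)
  ultimately show ?thesis
    using assms(1,2) by (auto simp: test_functions_def)
qed

lemma partial_deriv_test_function:
  assumes \<phi>: "\<phi> \<in> test_functions \<Omega>" and i: "i \<in> Basis"
  shows "partial_deriv i \<phi> \<in> test_functions \<Omega>"
proof (rule test_functionsI_support[OF \<phi>])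
  show "C_k k (partial_deriv i \<phi>)" for k
    using test_functionsD(1)[OF \<phi>, of "Suc k"] i by simp
  fix x
  assume "partial_deriv i \<phi> x \<noteq> 0"
  \<comment> \<open>Off the closed support \<phi> vanishes on a whole open neighbourhood, hence so
    does its derivative.\<close>
  moreover have "partial_deriv i \<phi> x = 0" if "x \<notin> closure {x. \<phi> x \<noteq> 0}"
  proof (rule partial_deriv_eqI[where f' = "\<lambda>_. 0", simplified])
    show "(\<phi> has_derivative (\<lambda>_. 0)) (at x)"
    proof (rule has_derivative_transform_within_open[OF has_derivative_const])
      show "open (- closure {x. \<phi> x \<noteq> 0})" "x \<in> - closure {x. \<phi> x \<noteq> 0}"
        using that by (simp_all add: open_Compl)
      show "0 = \<phi> y" if "y \<in> - closure {x. \<phi> x \<noteq> 0}" for y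
        using that subsetD[OF closure_subset, of y "{x. \<phi> x \<noteq> 0}"] by (cases "\<phi> y = 0") simp_all
    qed
  qed
  ultimately show "x \<in> closure {x. \<phi> x \<noteq> 0}"
    by blast
qed

lemma mult_test_function:
  assumes \<phi>: "\<phi> \<in> test_functions \<Omega>" and \<psi>: "\<psi> \<in> test_functions \<Omega>'"
  shows "(\<lambda>x. \<phi> x * \<psi> x) \<in> test_functions \<Omega>"
  by (rule test_functionsI_support[OF \<phi>])
    (auto intro!: C_k_mult test_functionsD(1)[OF \<phi>] test_functionsD(1)[OF \<psi>] subsetD[OF closure_subset])

lemma cnj_test_function:
  assumes \<phi>: "\<phi> \<in> test_functions \<Omega>"
  shows "(\<lambda>x. cnj (\<phi> x)) \<in> test_functions \<Omega>"
  by (rule test_functionsI_support[OF \<phi>])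
    (auto intro!: C_k_cnj test_functionsD(1)[OF \<phi>] subsetD[OF closure_subset])

section \<open>Integrals of test functions and integration by parts\<close>

lemma integral_restrict_support:
  fixes f :: "'a::euclidean_space \<Rightarrow> 'b::euclidean_space"
  assumes "S \<in> sets lebesgue" "\<And>x. x \<notin> S \<Longrightarrow> f x = 0"
  shows "integral\<^sup>L (lebesgue_on S) f = integral\<^sup>L lebesgue f"
proof -
  have "(\<lambda>x. if x \<in> S then f x else 0) = f"
    using assms(2) by auto
  then show ?thesis
    using Lebesgue_Measure.integral_restrict_UNIV[OF assms(1), of f] by simp
qed

lemma test_function_bounded:
  assumes "\<phi> \<in> test_functions \<Omega>"
  obtains B where "0 \<le> B" "\<And>x. cmod (\<phi> x) \<le> B"
proof -
  have "compact (\<phi> ` closure {x. \<phi> x \<noteq> 0})"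
    by (rule compact_continuous_image[OF continuous_on_subset[OF test_functionsD(2)[OF assms] subset_UNIV]
        test_functionsD(5)[OF assms]])
  then have "bounded (\<phi> ` closure {x. \<phi> x \<noteq> 0})"
    by (rule compact_imp_bounded)
  then obtain B where B: "0 < B" "\<forall>y\<in>\<phi> ` closure {x. \<phi> x \<noteq> 0}. cmod y \<le> B"
    unfolding bounded_pos by blast
  show ?thesis
  proof (rule that[of B])
    show "cmod (\<phi> x) \<le> B" for x
    proof (cases "\<phi> x = 0")
      case False
      then have "x \<in> closure {x. \<phi> x \<noteq> 0}"
        by (intro subsetD[OF closure_subset]) simp
      with B(2) show ?thesis
        by blast
    qed (use B(1) in simp)
  qed (use B(1) in simp)
qed

lemma integrable_test_function:
  assumes "\<phi> \<in> test_functions \<Omega>"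
  shows "integrable lborel \<phi>"
proof -
  have "integrable lborel (\<lambda>x. indicator (closure {x. \<phi> x \<noteq> 0}) x *\<^sub>R \<phi> x)"
    by (intro borel_integrable_compact continuous_on_subset[OF test_functionsD(2)[OF assms]]
        test_functionsD(5)[OF assms]) simp
  also have "(\<lambda>x. indicator (closure {x. \<phi> x \<noteq> 0}) x *\<^sub>R \<phi> x) = \<phi>"
  proof
    show "indicator (closure {x. \<phi> x \<noteq> 0}) x *\<^sub>R \<phi> x = \<phi> x" for x
      using subsetD[OF closure_subset, of x "{x. \<phi> x \<noteq> 0}"] by (cases "\<phi> x = 0") simp_all
  qed
  finally show ?thesis .
qed

lemma test_functions_subset_L2:
  assumes \<phi>: "\<phi> \<in> test_functions \<Omega>" and "\<Omega> \<in> sets lebesgue"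
  shows "\<phi> \<in> L2_space \<Omega>"
proof -
  have [measurable]: "\<phi> \<in> borel_measurable lebesgue"
    using borel_measurable_continuous_onI[OF test_functionsD(2)[OF \<phi>]]
    by (intro measurable_completion) (simp add: measurable_lborel1)
  \<comment> \<open>The squared modulus of \<phi> is the modulus of this product, which is itself a
    test function.\<close>
  have "integrable lborel (\<lambda>x. \<phi> x * cnj (\<phi> x))"
    by (rule integrable_test_function[OF mult_test_function[OF \<phi> cnj_test_function[OF \<phi>]]])
  then have "integrable lborel (\<lambda>x. cmod (\<phi> x * cnj (\<phi> x)))"
    by (rule integrable_norm)
  then have "integrable lebesgue (\<lambda>x. (cmod (\<phi> x))\<^sup>2)"
    by (simp add: norm_mult power2_eq_square integrable_completion borel_measurable_integrable)
  then have "integrable (lebesgue_on \<Omega>) (\<lambda>x. (cmod (\<phi> x))\<^sup>2)"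
    using integrable_lebesgue_on_subset[of UNIV "\<lambda>x. (cmod (\<phi> x))\<^sup>2" \<Omega>] assms
    by (simp add: lebesgue_on_UNIV_eq)
  then show ?thesis
    by (simp add: L2_space_def measurable_restrict_space1)
qed

text \<open>Differentiate the translation-invariant integral of \<open>\<phi>\<close> in the direction \<open>i\<close>.\<close>

lemma integral_partial_deriv_test_function:
  assumes \<phi>: "\<phi> \<in> test_functions \<Omega>" and i: "i \<in> Basis"
  shows "(\<integral>x. partial_deriv i \<phi> x \<partial>lborel) = 0"
proof -
  obtain B where B: "0 \<le> B" "\<And>x. cmod (partial_deriv i \<phi> x) \<le> B"
    using test_function_bounded[OF partial_deriv_test_function[OF \<phi> i]] by metis
  have [measurable]: "\<phi> \<in> borel_measurable borel" "partial_deriv i \<phi> \<in> borel_measurable borel"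
    using test_functionsD(2)[OF \<phi>] test_functionsD(2)[OF partial_deriv_test_function[OF \<phi> i]]
    by (auto intro: borel_measurable_continuous_onI)
  define K where "K = closure {x. \<phi> x \<noteq> 0}"
  \<comment> \<open>\<open>K1\<close> is the closed unit thickening of the support. All translation
    steps below have length at most 1, so every difference quotient vanishes outside
    \<open>K1\<close>, and \<open>B * indicator K1 x\<close> dominates them all.\<close>
  define K1 where "K1 = {x + y |x y. x \<in> K \<and> y \<in> cball 0 1}"
  have K: "compact K"
    unfolding K_def by (rule test_functionsD(5)[OF \<phi>])
  then have K1: "compact K1"
    unfolding K1_def by (intro compact_sums compact_cball)
  have vd: "((\<lambda>s. \<phi> (x + s *\<^sub>R i)) has_vector_derivative partial_deriv i \<phi> (x + s *\<^sub>R i)) (at s within S)" for x s S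
  proof -
    have "(\<phi> has_derivative frechet_derivative \<phi> (at (x + s *\<^sub>R i))) (at (x + s *\<^sub>R i))"
      using test_functionsD(3)[OF \<phi>] by (simp add: frechet_derivative_works[symmetric])
    then have "((\<lambda>s. \<phi> (x + s *\<^sub>R i)) has_derivative (\<lambda>h. frechet_derivative \<phi> (at (x + s *\<^sub>R i)) (h *\<^sub>R i))) (at s within S)"
      by (rule has_derivative_compose[rotated]) (auto intro!: derivative_eq_intros)
    moreover have "frechet_derivative \<phi> (at (x + s *\<^sub>R i)) (h *\<^sub>R i) = h *\<^sub>R partial_deriv i \<phi> (x + s *\<^sub>R i)" for h
      unfolding partial_deriv_def
      by (rule linear_cmul[OF linear_frechet_derivative[OF test_functionsD(3)[OF \<phi>]]])
    ultimately show ?thesis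
      by (simp add: has_vector_derivative_def)
  qed
  define q where "q n x = real (Suc n) *\<^sub>R (\<phi> (x + (1 / real (Suc n)) *\<^sub>R i) - \<phi> x)" for n x
  have bound: "norm (q n x) \<le> B * indicator K1 x" for n x
  proof (cases "x \<in> K1")
    case True
    \<comment> \<open>Mean value inequality along the segment in direction \<open>i\<close>; the
      step length 1/(n+1) it produces cancels the factor \<open>Suc n\<close> in
      \<open>q\<close>.\<close>
    have "norm (\<phi> (x + (1 / real (Suc n)) *\<^sub>R i) - \<phi> (x + 0 *\<^sub>R i)) \<le> B * norm (1 / real (Suc n) - 0)"
    proof (rule differentiable_bound[where S = UNIV and f' = "\<lambda>s h. h *\<^sub>R partial_deriv i \<phi> (x + s *\<^sub>R i)"])
      show "onorm (\<lambda>h. h *\<^sub>R partial_deriv i \<phi> (x + s *\<^sub>R i)) \<le> B" for s :: real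
        using B by (intro onorm_bound) (simp_all add: mult.commute[of B] mult_left_mono)
    qed (use vd in \<open>auto simp: has_vector_derivative_def\<close>)
    then have "real (Suc n) * norm (\<phi> (x + (1 / real (Suc n)) *\<^sub>R i) - \<phi> x) \<le> B"
      by (simp add: field_simps)
    with True show ?thesis
      by (simp add: q_def)
  next
    case False
    have "x \<notin> K"
      using False by (auto simp: K1_def intro!: exI[of _ x] exI[of _ 0])
    moreover have "x + (1 / real (Suc n)) *\<^sub>R i \<notin> K"
    proof
      assume "x + (1 / real (Suc n)) *\<^sub>R i \<in> K"
      moreover have "- ((1 / real (Suc n)) *\<^sub>R i) \<in> cball 0 1"
        using i by (simp add: field_simps)
      moreover have "x = (x + (1 / real (Suc n)) *\<^sub>R i) + - ((1 / real (Suc n)) *\<^sub>R i)"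
        by simp
      ultimately have "x \<in> K1"
        unfolding K1_def by blast
      with False show False ..
    qed
    ultimately have "\<phi> x = 0" "\<phi> (x + (1 / real (Suc n)) *\<^sub>R i) = 0"
      using subsetD[OF closure_subset, of _ "{x. \<phi> x \<noteq> 0}"] unfolding K_def mem_Collect_eq by metis+
    with False show ?thesis
      by (simp add: q_def)
  qed
  have lim: "(\<lambda>n. q n x) \<longlonglongrightarrow> partial_deriv i \<phi> x" for x
  proof -
    have "((\<lambda>h. norm (\<phi> (x + h *\<^sub>R i) - \<phi> x - h *\<^sub>R partial_deriv i \<phi> x) / \<bar>h\<bar>) \<longlongrightarrow> 0) (at 0)"
      using vd[of x 0 UNIV] by (simp add: has_vector_derivative_def has_derivative_iff_norm)
    moreover have "filterlim (\<lambda>n. 1 / real (Suc n)) (at 0) sequentially"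
      unfolding filterlim_at using LIMSEQ_inverse_real_of_nat by (simp add: inverse_eq_divide)
    ultimately have "(\<lambda>n. norm (\<phi> (x + (1 / real (Suc n)) *\<^sub>R i) - \<phi> x
        - (1 / real (Suc n)) *\<^sub>R partial_deriv i \<phi> x) / \<bar>1 / real (Suc n)\<bar>) \<longlonglongrightarrow> 0"
      by (rule filterlim_compose)
    also have "(\<lambda>n. norm (\<phi> (x + (1 / real (Suc n)) *\<^sub>R i) - \<phi> x
        - (1 / real (Suc n)) *\<^sub>R partial_deriv i \<phi> x) / \<bar>1 / real (Suc n)\<bar>)
        = (\<lambda>n. norm (q n x - partial_deriv i \<phi> x))"
    proof
      fix n
      have "q n x - partial_deriv i \<phi> x = real (Suc n) *\<^sub>R (\<phi> (x + (1 / real (Suc n)) *\<^sub>R i) - \<phi> x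
        - (1 / real (Suc n)) *\<^sub>R partial_deriv i \<phi> x)"
        by (simp add: q_def scaleR_diff_right del: of_nat_Suc)
      then show "norm (\<phi> (x + (1 / real (Suc n)) *\<^sub>R i) - \<phi> x
        - (1 / real (Suc n)) *\<^sub>R partial_deriv i \<phi> x) / \<bar>1 / real (Suc n)\<bar> = norm (q n x - partial_deriv i \<phi> x)"
        by (simp add: mult.commute del: of_nat_Suc)
    qed
    finally show ?thesis
      by (simp add: tendsto_norm_zero_iff LIM_zero_iff)
  qed
  have "(\<lambda>n. integral\<^sup>L lborel (q n)) \<longlonglongrightarrow> (\<integral>x. partial_deriv i \<phi> x \<partial>lborel)"
  proof (rule integral_dominated_convergence)
    show "integrable lborel (\<lambda>x. B * indicator K1 x :: real)"
      using K1 emeasure_compact_finite[OF K1]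
      by (intro integrable_mult_right integrable_real_indicator) (simp_all add: borel_compact)
    show "AE x in lborel. (\<lambda>n. q n x) \<longlonglongrightarrow> partial_deriv i \<phi> x"
      using lim by simp
    show "AE x in lborel. norm (q n x) \<le> B * indicator K1 x" for n
      using bound by simp
    show "q n \<in> borel_measurable lborel" for n
      unfolding q_def by measurable
  qed simp
  \<comment> \<open>By translation invariance both terms of the quotient have the same
    integral.\<close>
  moreover have "integral\<^sup>L lborel (q n) = 0" for n
  proof -
    have int: "integrable lborel \<phi>"
      by (rule integrable_test_function[OF \<phi>])
    let ?c = "(1 / real (Suc n)) *\<^sub>R i"
    have "integrable (distr lborel borel ((+) ?c)) \<phi>"
      using int by (simp add: lborel_distr_plus)
    then have int': "integrable lborel (\<lambda>x. \<phi> (x + ?c))"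
      by (subst (asm) integrable_distr_eq) (auto simp: add.commute)
    have "(\<integral>x. \<phi> (x + ?c) \<partial>lborel) = integral\<^sup>L (distr lborel borel ((+) ?c)) \<phi>"
      by (subst integral_distr) (auto simp: add.commute)
    then show ?thesis
      using int int' by (simp add: q_def[abs_def] lborel_distr_plus)
  qed
  ultimately show ?thesis
    by (simp add: LIMSEQ_const_iff)
qed

text \<open>The product of two test functions is again one, so its partial derivative integrates to
  zero; the product rule splits that integral into the two sides.\<close>

lemma is_weak_deriv_test_function:
  assumes \<phi>: "\<phi> \<in> test_functions \<Omega>" and i: "i \<in> Basis" and \<Omega>: "\<Omega> \<in> sets lebesgue"
  shows "is_weak_deriv \<Omega> i \<phi> (partial_deriv i \<phi>)"
proof -
  have "(\<integral>x. \<phi> x * partial_deriv i \<psi> x \<partial>lebesgue_on \<Omega>) = - (\<integral>x. partial_deriv i \<phi> x * \<psi> x \<partial>lebesgue_on \<Omega>)"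
    if \<psi>: "\<psi> \<in> test_functions \<Omega>" for \<psi>
  proof -
    note d = partial_deriv_test_function[OF \<phi> i] partial_deriv_test_function[OF \<psi> i]
    have "(\<integral>x. \<phi> x * partial_deriv i \<psi> x \<partial>lebesgue_on \<Omega>) + (\<integral>x. partial_deriv i \<phi> x * \<psi> x \<partial>lebesgue_on \<Omega>)
        = (\<integral>x. \<phi> x * partial_deriv i \<psi> x + partial_deriv i \<phi> x * \<psi> x \<partial>lebesgue_on \<Omega>)"
      using \<Omega> \<phi> \<psi> d by (intro Bochner_Integration.integral_add[symmetric] L2_integrable_mult test_functions_subset_L2)
    also have "\<dots> = (\<integral>x. partial_deriv i (\<lambda>x. \<phi> x * \<psi> x) x \<partial>lebesgue_on \<Omega>)"
      using test_functionsD(3)[OF \<phi>] test_functionsD(3)[OF \<psi>] by (simp add: partial_deriv_mult)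
    also have "\<dots> = (\<integral>x. partial_deriv i (\<lambda>x. \<phi> x * \<psi> x) x \<partial>lebesgue)"
      using \<Omega> test_functionsD(4)[OF partial_deriv_test_function[OF mult_test_function[OF \<phi> \<psi>] i]]
      by (rule integral_restrict_support)
    also have "\<dots> = (\<integral>x. partial_deriv i (\<lambda>x. \<phi> x * \<psi> x) x \<partial>lborel)"
      using test_functionsD(2)[OF partial_deriv_test_function[OF mult_test_function[OF \<phi> \<psi>] i]]
      by (intro integral_completion) (auto intro: borel_measurable_continuous_onI simp: measurable_lborel1)
    also have "\<dots> = 0"
      by (rule integral_partial_deriv_test_function[OF mult_test_function[OF \<phi> \<psi>] i])
    finally show ?thesis
      by (simp add: eq_neg_iff_add_eq_0)
  qed
  with assms show ?thesis
    by (auto simp: is_weak_deriv_def intro: test_functions_subset_L2 partial_deriv_test_function)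
qed


section \<open>Weak derivatives and the Dirichlet Laplacian\<close>

text \<open>
  Each \<open>e n\<close> is an \<open>L\<^sup>2\<close> limit of test functions, so completeness of the eigensystem yields the
  fundamental lemma of the calculus of variations without mollification in \<open>\<Omega>\<close>.
\<close>

lemma AE_zero_if_orthogonal_test_functions:
  assumes eig: "dirichlet_eigensystem \<Omega> ev e" and \<Omega>: "\<Omega> \<in> sets lebesgue"
    and h: "h \<in> L2_space \<Omega>"
    and orth: "\<And>\<psi>. \<psi> \<in> test_functions \<Omega> \<Longrightarrow> (\<integral>x. h x * \<psi> x \<partial>lebesgue_on \<Omega>) = 0"
  shows "AE x in lebesgue_on \<Omega>. h x = 0"
proof -
  have "L2_inner \<Omega> h (e n) = 0" if n: "1 \<le> n" for n
  proof -
    have en: "e n \<in> H10_space \<Omega>"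
      using eig n by (auto simp: dirichlet_eigensystem_def)
    then obtain \<phi> where \<phi>: "\<And>k. \<phi> k \<in> test_functions \<Omega>"
      and lim: "(\<lambda>k::nat. H1_norm \<Omega> (\<lambda>x. e n x - \<phi> k x)) \<longlonglongrightarrow> 0"
      unfolding H10_space_def by blast
    \<comment> \<open>Only the domination of the L2 norm by the H1 norm is used, which holds
      whatever \<open>weak_deriv\<close> chose. This avoids a circle: uniqueness of weak derivatives
      is itself deduced from this lemma.\<close>
    have "(\<lambda>k. L2_norm \<Omega> (\<lambda>x. e n x - \<phi> k x)) \<longlonglongrightarrow> 0"
      by (rule Lim_null_comparison[OF always_eventually lim])
        (auto simp: H1_norm_def intro!: real_le_rsqrt sum_nonneg)
    \<comment> \<open>\<open>L2_inner\<close> conjugates its second argument while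
      \<open>orth\<close> is bilinear. Conjugation preserves both the norm and the class of test
      functions, which reconciles the two.\<close>
    then have lim': "(\<lambda>k. L2_norm \<Omega> (\<lambda>x. cnj (e n x) - cnj (\<phi> k x))) \<longlonglongrightarrow> 0"
      by (simp flip: complex_cnj_diff)
    have "e n \<in> L2_space \<Omega>"
      using en by (simp add: H10_space_def H1_space_def)
    then have "(\<lambda>k. \<integral>x. h x * cnj (\<phi> k x) \<partial>lebesgue_on \<Omega>) \<longlonglongrightarrow> (\<integral>x. h x * cnj (e n x) \<partial>lebesgue_on \<Omega>)"
      using \<phi> \<Omega> by (intro L2_pairing_tendsto[OF h _ always_eventually lim'])
        (auto intro: L2_space_cnj test_functions_subset_L2)
    then show ?thesis
      using orth[OF cnj_test_function[OF \<phi>]] by (simp add: L2_inner_def LIMSEQ_const_iff)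
  qed
  then show ?thesis
    using eig h by (simp add: dirichlet_eigensystem_def)
qed

lemma is_weak_deriv_diff:
  assumes \<Omega>: "\<Omega> \<in> sets lebesgue" and i: "i \<in> Basis"
    and f: "is_weak_deriv \<Omega> i f f'" and h: "is_weak_deriv \<Omega> i h h'"
  shows "is_weak_deriv \<Omega> i (\<lambda>x. f x - h x) (\<lambda>x. f' x - h' x)"
proof -
  have L2: "f \<in> L2_space \<Omega>" "f' \<in> L2_space \<Omega>" "h \<in> L2_space \<Omega>" "h' \<in> L2_space \<Omega>"
    using f h by (auto simp: is_weak_deriv_def)
  have "(\<integral>x. (f x - h x) * partial_deriv i \<phi> x \<partial>lebesgue_on \<Omega>) = - (\<integral>x. (f' x - h' x) * \<phi> x \<partial>lebesgue_on \<Omega>)"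
    if \<phi>: "\<phi> \<in> test_functions \<Omega>" for \<phi>
    using f h L2 \<phi> test_functions_subset_L2[OF \<phi> \<Omega>] test_functions_subset_L2[OF partial_deriv_test_function[OF \<phi> i] \<Omega>]
    by (simp add: L2_pairing_diff_left is_weak_deriv_def)
  with L2 show ?thesis
    by (simp add: is_weak_deriv_def L2_space_diff)
qed

text \<open>Makes any two choices of a weak derivative comparable, in particular the one chosen for
  a difference with the difference of the chosen ones.\<close>

lemma is_weak_deriv_unique:
  assumes eig: "dirichlet_eigensystem \<Omega> ev e" and \<Omega>: "\<Omega> \<in> sets lebesgue"
    and f1: "is_weak_deriv \<Omega> i f h1" and f2: "is_weak_deriv \<Omega> i f h2"
  shows "AE x in lebesgue_on \<Omega>. h1 x = h2 x"
proof -
  have L2: "h1 \<in> L2_space \<Omega>" "h2 \<in> L2_space \<Omega>"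
    using f1 f2 by (auto simp: is_weak_deriv_def)
  have "AE x in lebesgue_on \<Omega>. h1 x - h2 x = 0"
  proof (rule AE_zero_if_orthogonal_test_functions[OF eig \<Omega> L2_space_diff[OF L2]])
    fix \<psi>
    assume \<psi>: "\<psi> \<in> test_functions \<Omega>"
    then show "(\<integral>x. (h1 x - h2 x) * \<psi> x \<partial>lebesgue_on \<Omega>) = 0"
      using f1 f2 L2 test_functions_subset_L2[OF \<psi> \<Omega>]
      by (simp add: L2_pairing_diff_left is_weak_deriv_def equation_minus_iff)
  qed
  then show ?thesis
    by simp
qed

lemma is_weak_deriv_weak_deriv:
  "f \<in> H1_space \<Omega> \<Longrightarrow> i \<in> Basis \<Longrightarrow> is_weak_deriv \<Omega> i f (weak_deriv \<Omega> i f)"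
  unfolding weak_deriv_def by (rule someI_ex[of "is_weak_deriv \<Omega> i f"]) (simp add: H1_space_def)

lemma weak_deriv_in_L2: "f \<in> H1_space \<Omega> \<Longrightarrow> i \<in> Basis \<Longrightarrow> weak_deriv \<Omega> i f \<in> L2_space \<Omega>"
  using is_weak_deriv_weak_deriv by (auto simp: is_weak_deriv_def)

lemma L2_norm_cong_AE:
  assumes "AE x in lebesgue_on \<Omega>. f x = h x" "f \<in> L2_space \<Omega>" "h \<in> L2_space \<Omega>"
  shows "L2_norm \<Omega> f = L2_norm \<Omega> h"
  unfolding L2_norm_def
  using assms L2_spaceD(1)[OF assms(2)] L2_spaceD(1)[OF assms(3)]
  by (intro arg_cong[where f = sqrt] integral_cong_AE) auto

text \<open>For a test function in place of \<open>q\<close> this is the definition of the weak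
  derivative of \<open>k\<close>. Both sides are continuous in \<open>q\<close> for the H1 norm, and
  \<open>q\<close> is an H1 limit of test functions, so no boundary term appears.\<close>

lemma H1_H10_integration_by_parts:
  assumes eig: "dirichlet_eigensystem \<Omega> ev e" and \<Omega>: "\<Omega> \<in> sets lebesgue" and i: "i \<in> Basis"
    and k: "k \<in> H1_space \<Omega>" and q: "q \<in> H10_space \<Omega>"
  shows "(\<integral>x. weak_deriv \<Omega> i k x * q x \<partial>lebesgue_on \<Omega>) = - (\<integral>x. k x * weak_deriv \<Omega> i q x \<partial>lebesgue_on \<Omega>)"
proof -
  obtain \<phi> where \<phi>: "\<And>n. \<phi> n \<in> test_functions \<Omega>"
    and lim: "(\<lambda>n::nat. H1_norm \<Omega> (\<lambda>x. q x - \<phi> n x)) \<longlonglongrightarrow> 0" and q1: "q \<in> H1_space \<Omega>"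
    using q unfolding H10_space_def by blast
  have L2: "k \<in> L2_space \<Omega>" "q \<in> L2_space \<Omega>"
    using k q1 by (auto simp: H1_space_def)
  have lim0: "(\<lambda>n. L2_norm \<Omega> (\<lambda>x. q x - \<phi> n x)) \<longlonglongrightarrow> 0"
    by (rule Lim_null_comparison[OF always_eventually lim])
      (auto simp: H1_norm_def intro!: real_le_rsqrt sum_nonneg)
  \<comment> \<open>The H1 norm of \<open>q - \<phi> n\<close> contains the derivative chosen for
    that difference, which equals the difference of the derivatives only almost everywhere.\<close>
  have lim1: "(\<lambda>n. L2_norm \<Omega> (\<lambda>x. weak_deriv \<Omega> i q x - partial_deriv i (\<phi> n) x)) \<longlonglongrightarrow> 0"
  proof (rule Lim_null_comparison[OF always_eventually lim], rule allI)
    fix n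
    have d: "is_weak_deriv \<Omega> j (\<lambda>x. q x - \<phi> n x) (\<lambda>x. weak_deriv \<Omega> j q x - partial_deriv j (\<phi> n) x)"
      if "j \<in> Basis" for j
      using that by (intro is_weak_deriv_diff[OF \<Omega>] is_weak_deriv_weak_deriv[OF q1] is_weak_deriv_test_function[OF \<phi> _ \<Omega>])
    then have "(\<lambda>x. q x - \<phi> n x) \<in> H1_space \<Omega>"
      using i by (auto simp: H1_space_def is_weak_deriv_def)
    from is_weak_deriv_weak_deriv[OF this i]
    have d': "is_weak_deriv \<Omega> i (\<lambda>x. q x - \<phi> n x) (weak_deriv \<Omega> i (\<lambda>x. q x - \<phi> n x))" .
    have "L2_norm \<Omega> (\<lambda>x. weak_deriv \<Omega> i q x - partial_deriv i (\<phi> n) x) = L2_norm \<Omega> (weak_deriv \<Omega> i (\<lambda>x. q x - \<phi> n x))"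
      using d[OF i] d' by (intro L2_norm_cong_AE is_weak_deriv_unique[OF eig \<Omega> d[OF i] d'])
        (auto simp: is_weak_deriv_def)
    also have "\<dots> \<le> H1_norm \<Omega> (\<lambda>x. q x - \<phi> n x)"
    proof -
      have "(L2_norm \<Omega> (weak_deriv \<Omega> i (\<lambda>x. q x - \<phi> n x)))\<^sup>2
          \<le> (\<Sum>j\<in>Basis. (L2_norm \<Omega> (weak_deriv \<Omega> j (\<lambda>x. q x - \<phi> n x)))\<^sup>2)"
        using i by (intro member_le_sum) simp_all
      then show ?thesis
        unfolding H1_norm_def by (intro real_le_rsqrt) (simp add: add_increasing)
    qed
    finally show "norm (L2_norm \<Omega> (\<lambda>x. weak_deriv \<Omega> i q x - partial_deriv i (\<phi> n) x)) \<le> H1_norm \<Omega> (\<lambda>x. q x - \<phi> n x)"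
      by simp
  qed
  have "(\<lambda>n. \<integral>x. weak_deriv \<Omega> i k x * \<phi> n x \<partial>lebesgue_on \<Omega>) \<longlonglongrightarrow> (\<integral>x. weak_deriv \<Omega> i k x * q x \<partial>lebesgue_on \<Omega>)"
    using \<phi> \<Omega> by (intro L2_pairing_tendsto[OF weak_deriv_in_L2[OF k i] L2(2) always_eventually lim0] allI test_functions_subset_L2)
  moreover have "(\<integral>x. weak_deriv \<Omega> i k x * \<phi> n x \<partial>lebesgue_on \<Omega>) = - (\<integral>x. k x * partial_deriv i (\<phi> n) x \<partial>lebesgue_on \<Omega>)" for n
    using is_weak_deriv_weak_deriv[OF k i] \<phi>[of n] by (simp add: is_weak_deriv_def)
  moreover have "(\<lambda>n. - (\<integral>x. k x * partial_deriv i (\<phi> n) x \<partial>lebesgue_on \<Omega>)) \<longlonglongrightarrow> - (\<integral>x. k x * weak_deriv \<Omega> i q x \<partial>lebesgue_on \<Omega>)"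
    using \<phi> \<Omega> i by (intro tendsto_minus L2_pairing_tendsto[OF L2(1) weak_deriv_in_L2[OF q1 i] always_eventually lim1] allI
        test_functions_subset_L2 partial_deriv_test_function)
  ultimately show ?thesis
    by (simp add: LIMSEQ_unique)
qed

text \<open>Green's first identity. Its right-hand side is symmetric in \<open>p\<close> and
  \<open>q\<close>, which is the source of the symmetry of the Laplacian. The integrability claim
  allows integrals containing a Laplacian to be split later.\<close>

lemma laplacian_pairing:
  assumes eig: "dirichlet_eigensystem \<Omega> ev e" and \<Omega>: "\<Omega> \<in> sets lebesgue"
    and p: "p \<in> H2_space \<Omega>" and q: "q \<in> H10_space \<Omega>"
  shows "(\<integral>x. laplacian \<Omega> p x * q x \<partial>lebesgue_on \<Omega>) =
      - (\<Sum>i\<in>Basis. \<integral>x. weak_deriv \<Omega> i p x * weak_deriv \<Omega> i q x \<partial>lebesgue_on \<Omega>)" (is ?eq)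
    and "integrable (lebesgue_on \<Omega>) (\<lambda>x. laplacian \<Omega> p x * q x)" (is ?int)
proof -
  have p1: "weak_deriv \<Omega> i p \<in> H1_space \<Omega>" if "i \<in> Basis" for i
    using p that by (auto simp: H2_space_def)
  have q0: "q \<in> L2_space \<Omega>"
    using q by (simp add: H10_space_def H1_space_def)
  have int: "integrable (lebesgue_on \<Omega>) (\<lambda>x. weak_deriv \<Omega> i (weak_deriv \<Omega> i p) x * q x)" if "i \<in> Basis" for i
    using that by (intro L2_integrable_mult weak_deriv_in_L2 p1 q0)
  show ?int
    unfolding laplacian_def sum_distrib_right by (intro Bochner_Integration.integrable_sum int)
  show ?eq
    unfolding laplacian_def sum_distrib_right
    by (simp add: Bochner_Integration.integral_sum int H1_H10_integration_by_parts[OF eig \<Omega> _ p1 q] sum_negf)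
qed

lemma laplacian_symmetric:
  assumes "dirichlet_eigensystem \<Omega> ev e" and "\<Omega> \<in> sets lebesgue"
    and "p \<in> H10_space \<Omega> \<inter> H2_space \<Omega>" and "q \<in> H10_space \<Omega> \<inter> H2_space \<Omega>"
  shows "(\<integral>x. laplacian \<Omega> p x * q x \<partial>lebesgue_on \<Omega>) = (\<integral>x. p x * laplacian \<Omega> q x \<partial>lebesgue_on \<Omega>)"
  using laplacian_pairing(1)[OF assms(1,2), of p q] laplacian_pairing(1)[OF assms(1,2), of q p] assms(3,4)
  by (simp add: mult.commute)


section \<open>Weak derivatives of functions of time\<close>

lemma partial_deriv_1_eq: "(f has_vector_derivative f') (at x) \<Longrightarrow> partial_deriv 1 f x = f'"
  by (simp add: has_vector_derivative_def partial_deriv_eqI)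

lemma C_k_SucI_vector_derivative:
  assumes "\<And>x. (f has_vector_derivative f' x) (at x)" and "C_k k f'"
  shows "C_k (Suc k) f"
proof -
  have "partial_deriv 1 f = f'"
    using partial_deriv_1_eq[OF assms(1)] by auto
  moreover have "f differentiable at x" for x
    using assms(1)[of x] by (auto simp: has_vector_derivative_def differentiable_def)
  ultimately show ?thesis
    using assms(2) by simp
qed

section \<open>Construction of a smooth step function on the line\<close>

lemma C_k_const: "C_k k (\<lambda>_::'a::euclidean_space. c)"
proof (induction k arbitrary: c)
  case (Suc k)
  have "partial_deriv i (\<lambda>_::'a. c) = (\<lambda>_. 0)" for i
    by (rule ext, rule partial_deriv_eqI[where f' = "\<lambda>_. 0"]) simp
  with Suc show ?case
    by simp
qed simp

text \<open>Lets a fixed smooth profile be reflected, shifted and rescaled.\<close>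

lemma C_k_real_affine:
  fixes f :: "real \<Rightarrow> complex"
  shows "C_k k f \<Longrightarrow> C_k k (\<lambda>x. f (c * x + d))"
proof (induction k arbitrary: f)
  case 0
  then show ?case
    by (auto intro!: continuous_on_compose2[of UNIV f] continuous_intros)
next
  case (Suc k)
  show ?case
  proof (rule C_k_SucI_vector_derivative)
    fix x
    have "f differentiable at (c * x + d)"
      using Suc.prems by simp
    then have "(f has_vector_derivative partial_deriv 1 f (c * x + d)) (at (c * x + d))"
      by (metis has_vector_derivative_def partial_deriv_1_eq vector_derivative_works)
    moreover have "((\<lambda>x. c * x + d) has_real_derivative c) (at x)"
      by (auto intro!: derivative_eq_intros)
    ultimately have "(f \<circ> (\<lambda>x. c * x + d) has_vector_derivative c *\<^sub>R partial_deriv 1 f (c * x + d)) (at x)"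
      by (intro vector_diff_chain_at) (simp add: has_real_derivative_iff_has_vector_derivative)
    then show "((\<lambda>x. f (c * x + d)) has_vector_derivative of_real c * partial_deriv 1 f (c * x + d)) (at x)"
      by (simp add: o_def scaleR_conv_of_real)
  next
    show "C_k k (\<lambda>x. of_real c * partial_deriv 1 f (c * x + d))"
      using Suc by (intro C_k_mult C_k_const Suc.IH) simp
  qed
qed

text \<open>For \<open>n = 0\<close> this is the standard flat function exp(-1/x). The powers of 1/x
  make the linear span of the family closed under differentiation, so smoothness follows by
  induction.\<close>

definition flat_exp :: "nat \<Rightarrow> real \<Rightarrow> real" where
  "flat_exp n x = (if 0 < x then (1 / x) ^ n * exp (- (1 / x)) else 0)"

lemma flat_exp_tendsto_0: "(flat_exp n \<longlongrightarrow> 0) (at 0)"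
proof (rule filterlim_split_at)
  show "(flat_exp n \<longlongrightarrow> 0) (at_left 0)"
    by (rule tendsto_eventually) (auto simp: flat_exp_def eventually_at_filter)
  have "((\<lambda>x. inverse x ^ n / exp (inverse x)) \<longlongrightarrow> (0::real)) (at_right 0)"
    by (rule filterlim_compose[OF tendsto_power_div_exp_0 filterlim_inverse_at_top_right])
  then show "(flat_exp n \<longlongrightarrow> 0) (at_right 0)"
    by (rule Lim_transform_eventually)
      (auto simp: flat_exp_def eventually_at_filter exp_minus field_simps)
qed

lemma flat_exp_derivative:
  "(flat_exp n has_real_derivative flat_exp (n + 2) x - n * flat_exp (n + 1) x) (at x)"
proof -
  consider "x < 0" | "x = 0" | "0 < x"
    by linarith
  then show ?thesis
  proof cases
    case 1
    then have "(flat_exp n has_real_derivative 0) (at x)"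
      by (intro has_field_derivative_transform_within_open[OF DERIV_const, where S = "{..<0}"])
        (auto simp: flat_exp_def)
    with 1 show ?thesis
      by (simp add: flat_exp_def)
  next
    case 2
    \<comment> \<open>At the origin the difference quotient of \<open>flat_exp n\<close> is
      \<open>flat_exp (Suc n)\<close>, which tends to 0.\<close>
    have "((\<lambda>h. (flat_exp n h - flat_exp n 0) / h) \<longlongrightarrow> 0) (at 0)"
      by (rule Lim_transform_eventually[OF flat_exp_tendsto_0[of "Suc n"]])
        (auto simp: flat_exp_def eventually_at_filter)
    with 2 show ?thesis
      by (simp add: DERIV_def flat_exp_def)
  next
    case 3
    define y where "y = 1 / x"
    have "((\<lambda>x. 1 / x) has_real_derivative - (y\<^sup>2)) (at x)"
      using 3 by (auto intro!: derivative_eq_intros simp: y_def power2_eq_square)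
    from DERIV_mult[OF DERIV_power[OF this, of n] DERIV_fun_exp[OF DERIV_minus[OF this]]]
    have D: "((\<lambda>x. (1 / x) ^ n * exp (- (1 / x))) has_real_derivative
        n * y ^ (n - 1) * - (y\<^sup>2) * exp (- y) + y ^ n * (exp (- y) * y\<^sup>2)) (at x)"
      by (rule DERIV_cong) (simp only: y_def, simp add: algebra_simps)
    have flat: "flat_exp m x = y ^ m * exp (- y)" for m
      using 3 by (simp add: flat_exp_def y_def)
    have E: "n * y ^ (n - 1) * - (y\<^sup>2) * exp (- y) + y ^ n * (exp (- y) * y\<^sup>2) =
        flat_exp (n + 2) x - n * flat_exp (n + 1) x"
    \<comment> \<open>For \<open>n = 0\<close> the exponent \<open>n - 1\<close> is truncated to 0,
      harmlessly since the factor \<open>n\<close> vanishes; hence the case split.\<close>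
    proof (cases n)
      case (Suc k)
      then show ?thesis
        by (simp add: flat power2_eq_square algebra_simps)
    qed (simp add: flat power2_eq_square)
    show ?thesis
    proof (rule has_field_derivative_transform_within_open[OF DERIV_cong[OF D E]])
      show "(1 / z) ^ n * exp (- (1 / z)) = flat_exp n z" if "z \<in> {0<..}" for z
        using that by (simp add: flat_exp_def)
    qed (use 3 in simp_all)
  qed
qed

lemma C_k_flat_exp: "C_k k (\<lambda>x. complex_of_real (flat_exp n x))"
proof (induction k arbitrary: n)
  case 0
  show ?case
    unfolding C_k.simps
    by (rule continuous_on_of_real, rule DERIV_continuous_on, rule has_field_derivative_at_within, rule flat_exp_derivative)
next
  case (Suc k)
  show ?case
  proof (rule C_k_SucI_vector_derivative)
    show "((\<lambda>x. complex_of_real (flat_exp n x)) has_vector_derivative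
        complex_of_real (flat_exp (n + 2) x) + (- of_nat n) * complex_of_real (flat_exp (n + 1) x)) (at x)" for x
    proof -
      have eq: "complex_of_real (flat_exp (n + 2) x) + (- of_nat n) * complex_of_real (flat_exp (n + 1) x) =
          complex_of_real (flat_exp (n + 2) x - n * flat_exp (n + 1) x)"
        by simp
      show ?thesis
        unfolding eq by (rule has_vector_derivative_of_real[OF flat_exp_derivative])
    qed
    show "C_k k (\<lambda>x. complex_of_real (flat_exp (n + 2) x) + (- of_nat n) * complex_of_real (flat_exp (n + 1) x))"
      by (rule C_k_add[OF Suc.IH C_k_mult[OF C_k_const Suc.IH]])
  qed
qed

text \<open>The antiderivative of a bump on the unit interval, divided by its total mass. Rescaled,
  \<sigma> approximates a jump from 0 to 1 while \<theta> becomes a nonnegative mollifier of mass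
  1.\<close>

lemma smooth_step_exists:
  obtains \<sigma> \<theta> :: "real \<Rightarrow> real" where
    "\<And>x. (\<sigma> has_real_derivative \<theta> x) (at x)" "\<And>k. C_k k (\<lambda>x. complex_of_real (\<theta> x))"
    "\<And>x. 0 \<le> \<theta> x" "\<And>x. x \<notin> {0..1} \<Longrightarrow> \<theta> x = 0"
    "\<And>x. x \<le> 0 \<Longrightarrow> \<sigma> x = 0" "\<And>x. 1 \<le> x \<Longrightarrow> \<sigma> x = 1" "\<And>x. \<bar>\<sigma> x\<bar> \<le> 1"
proof -
  define \<eta> where "\<eta> x = flat_exp 0 x * flat_exp 0 (1 - x)" for x
  \<comment> \<open>The lower limit -1 makes every nonnegative point, including 0, interior to the
    interval on which \<open>H\<close> is differentiated.\<close>
  define H where "H x = integral {-1..x} \<eta>" for x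
  have \<eta>0: "0 \<le> \<eta> x" for x
    by (simp add: \<eta>_def flat_exp_def)
  have \<eta>_zero: "\<eta> x = 0" if "x \<le> 0 \<or> 1 \<le> x" for x
    using that by (auto simp: \<eta>_def flat_exp_def)
  have C: "C_k k (\<lambda>x. complex_of_real (\<eta> x))" for k
    using C_k_mult[OF C_k_flat_exp[of k 0] C_k_real_affine[OF C_k_flat_exp[of k 0], of "-1" 1]]
    by (simp add: \<eta>_def)
  have cont: "continuous_on S \<eta>" for S
    using continuous_on_Re[OF continuous_on_subset[OF C_k_imp_continuous[OF C[of 0]] subset_UNIV[of S]]] by simp
  have H0: "H x = 0" if "x \<le> 0" for x
  proof -
    have "integral {-1..x} \<eta> = integral {-1..x} (\<lambda>_. 0)"
      using that by (intro Henstock_Kurzweil_Integration.integral_cong \<eta>_zero) simp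
    then show ?thesis
      by (simp add: H_def)
  qed
  have H1: "H x = H 1" if "1 \<le> x" for x
  proof -
    have "integral {-1..1} \<eta> + integral {1..x} \<eta> = integral {-1..x} \<eta>"
      using that integrable_continuous_real[OF cont]
      by (intro Henstock_Kurzweil_Integration.integral_combine) simp_all
    moreover have "integral {1..x} \<eta> = integral {1..x} (\<lambda>_. 0)"
      by (intro Henstock_Kurzweil_Integration.integral_cong \<eta>_zero) simp
    ultimately show ?thesis
      by (simp add: H_def)
  qed
  have Hd: "(H has_real_derivative \<eta> x) (at x)" for x
  proof (cases "x < 0")
    case True
    then have "(H has_real_derivative 0) (at x)"
      by (intro has_field_derivative_transform_within_open[OF DERIV_const, where S = "{..<0}"]) (auto simp: H0)
    with True show ?thesis
      by (simp add: \<eta>_zero)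
  next
    case False
    then have "(H has_real_derivative \<eta> x) (at x within {-1..x+1})"
      unfolding H_def[abs_def] by (intro integral_has_real_derivative cont) auto
    with False show ?thesis
      by (simp add: at_within_Icc_at)
  qed
  have mono: "H x \<le> H y" if "x \<le> y" for x y
    using that by (rule DERIV_nonneg_imp_nondecreasing) (use Hd \<eta>0 in blast)
  \<comment> \<open>If the total mass vanished, the continuous nonnegative \<eta> would vanish on
    the interval, but it is positive at 1/2.\<close>
  have pos: "0 < H 1"
  proof -
    have "H 1 \<noteq> 0"
    proof
      assume "H 1 = 0"
      then have "\<forall>x\<in>{-1..1}. \<eta> x = 0"
        unfolding H_def using integral_eq_0_iff[OF cont] \<eta>0 by fastforce
      then have "\<eta> (1/2) = 0"
        by simp
      then show False
        by (simp add: \<eta>_def flat_exp_def)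
    qed
    with mono[of 0 1] H0[of 0] show ?thesis
      by simp
  qed
  show ?thesis
  proof (rule that[of "\<lambda>x. H x / H 1" "\<lambda>x. \<eta> x / H 1"])
    show "((\<lambda>x. H x / H 1) has_real_derivative \<eta> x / H 1) (at x)" for x
      by (rule DERIV_cdivide[OF Hd])
    show "C_k k (\<lambda>x. complex_of_real (\<eta> x / H 1))" for k
      using C_k_mult[OF C[of k] C_k_const[of k "inverse (complex_of_real (H 1))"]]
      by (simp add: divide_inverse)
    show "\<bar>H x / H 1\<bar> \<le> 1" for x
    proof -
      have "0 \<le> H x" "H x \<le> H 1"
        using mono[of x 1] H1[of x] mono[of 0 x] mono[of 0 1] H0[of x] H0[of 0] by linarith+
      with pos show ?thesis
        by simp
    qed
    show "H x / H 1 = 1" if "1 \<le> x" for x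
      using that H1[of x] pos by simp
    show "0 \<le> \<eta> x / H 1" for x
      using \<eta>0[of x] pos by simp
    show "\<eta> x / H 1 = 0" if "x \<notin> {0..1}" for x
      using that \<eta>_zero[of x] by (simp add: not_le) linarith
  qed (simp add: H0)
qed

section \<open>Integrals cut off to a part of the time interval\<close>

lemma AE_lebesgue_on_neq: "A \<in> sets lebesgue \<Longrightarrow> AE x in lebesgue_on A. x \<noteq> (c::'a::euclidean_space)"
  using AE_completion[OF AE_lborel_singleton[of c]] by (simp add: AE_restrict_space_iff) (auto elim: eventually_mono)

text \<open>Cutting by an indicator keeps one measure for all subintervals, so additivity and
  convergence concern integrands only. Half-open intervals fit together without overlap.\<close>

abbreviation cut_integral :: "real measure \<Rightarrow> real \<Rightarrow> real \<Rightarrow> (real \<Rightarrow> 'b) \<Rightarrow> 'b::{banach, second_countable_topology}" where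
  "cut_integral M s t n \<equiv> (\<integral>r. indicator {s<..t} r *\<^sub>R n r \<partial>M)"

lemma indicator_Ioc_measurable [measurable]:
  "(\<lambda>r::real. indicator {s<..t} r :: real) \<in> borel_measurable (lebesgue_on A)"
  by (intro measurable_restrict_space1 measurable_completion) simp

lemma integrable_cut:
  fixes n :: "real \<Rightarrow> 'b::{banach, second_countable_topology}"
  assumes "integrable (lebesgue_on A) n"
  shows "integrable (lebesgue_on A) (\<lambda>r. indicator {s<..t} r *\<^sub>R n r)"
  by (rule Bochner_Integration.integrable_bound[OF assms
        borel_measurable_scaleR[OF indicator_Ioc_measurable borel_measurable_integrable[OF assms]]])
    (simp add: indicator_def)

lemma cut_integral_add:
  fixes n :: "real \<Rightarrow> 'b::{banach, second_countable_topology}"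
  assumes "integrable (lebesgue_on A) n" "s \<le> t" "t \<le> q"
  shows "cut_integral (lebesgue_on A) s t n + cut_integral (lebesgue_on A) t q n = cut_integral (lebesgue_on A) s q n"
proof -
  have *: "indicator {s<..t} r *\<^sub>R n r + indicator {t<..q} r *\<^sub>R n r = indicator {s<..q} r *\<^sub>R n r" for r
    using assms(2,3) by (auto split: split_indicator)
  show ?thesis
    using assms(1) by (simp add: Bochner_Integration.integral_add[symmetric] integrable_cut * del: Bochner_Integration.integral_add)
qed

lemma continuous_on_cut_integral:
  fixes n :: "real \<Rightarrow> 'b::{banach, second_countable_topology}"
  assumes int: "integrable (lebesgue_on A) n" and A: "A \<in> sets lebesgue"
  shows "continuous_on T (\<lambda>t. cut_integral (lebesgue_on A) s t n)"
  unfolding continuous_on_sequentially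
proof (intro allI ballI impI, unfold o_def)
  fix X :: "nat \<Rightarrow> real" and x
  assume X: "(\<forall>k. X k \<in> T) \<and> X \<longlonglongrightarrow> x"
  show "(\<lambda>k. cut_integral (lebesgue_on A) s (X k) n) \<longlonglongrightarrow> cut_integral (lebesgue_on A) s x n"
  proof (rule integral_dominated_convergence)
    show "integrable (lebesgue_on A) (\<lambda>r. norm (n r))"
      using int by simp
    \<comment> \<open>The indicators converge at every \<open>r\<close> except possibly the endpoint
      \<open>x\<close>, a null set.\<close>
    show "AE r in lebesgue_on A. (\<lambda>k. indicator {s<..X k} r *\<^sub>R n r) \<longlonglongrightarrow> indicator {s<..x} r *\<^sub>R n r"
      using AE_lebesgue_on_neq[OF A, of x]
    proof eventually_elim
      case (elim r)
      have "\<forall>\<^sub>F k in sequentially. (r \<le> X k \<longleftrightarrow> r \<le> x)"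
      proof (cases "r < x")
        case True
        with X have "\<forall>\<^sub>F k in sequentially. r < X k"
          by (auto dest: order_tendstoD)
        then show ?thesis
          by eventually_elim (use True in simp)
      next
        case False
        with elim have "x < r"
          by simp
        with X have "\<forall>\<^sub>F k in sequentially. X k < r"
          by (auto dest: order_tendstoD)
        then show ?thesis
          by eventually_elim (use False elim in simp)
      qed
      then show ?case
        by (intro tendsto_eventually, eventually_elim) (simp add: indicator_def)
    qed
    show "AE r in lebesgue_on A. norm (indicator {s<..X k} r *\<^sub>R n r) \<le> norm (n r)" for k
      by (simp add: indicator_def)
  qed (use borel_measurable_integrable[OF int] in \<open>auto intro: borel_measurable_scaleR\<close>)
qed


section \<open>Fundamental theorem for weak derivatives in time\<close>

lemma continuous_lebesgue_on_Ioo: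
  fixes f :: "real \<Rightarrow> real"
  assumes "continuous_on {0..S} f"
  shows "integrable (lebesgue_on {0<..<S}) f"
    and "integral\<^sup>L (lebesgue_on {0<..<S}) f = integral {0..S} f"
proof -
  show int: "integrable (lebesgue_on {0<..<S}) f"
    by (rule integrable_lebesgue_on_subset[OF continuous_imp_integrable_real[OF assms]])
      (auto simp: greaterThanLessThan_subseteq_atLeastAtMost_iff)
  show "integral\<^sup>L (lebesgue_on {0<..<S}) f = integral {0..S} f"
    using lebesgue_integral_eq_integral[OF int] by (simp add: integral_open_interval_real)
qed

text \<open>Testing with a smoothed indicator of (s,t] puts mollifiers at \<open>s\<close> and
  \<open>t\<close> on the side of \<open>m\<close> and, in the limit, gives the integral of
  \<open>n\<close> over (s,t] on the other. Continuity of \<open>m\<close> turns the mollified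
  values into point values.\<close>

lemma weak_derivative_cut_integral:
  fixes m n :: "real \<Rightarrow> complex"
  assumes cont: "continuous_on {0..S} m" and int: "integrable (lebesgue_on {0<..<S}) n"
    and weak: "\<And>\<psi>. \<psi> \<in> test_functions {0<..<S} \<Longrightarrow>
      (\<integral>r. partial_deriv 1 \<psi> r * m r \<partial>lebesgue_on {0<..<S}) = - (\<integral>r. \<psi> r * n r \<partial>lebesgue_on {0<..<S})"
    and st: "0 \<le> s" "s \<le> t" "t \<le> S"
  shows "m t - m s = cut_integral (lebesgue_on {0<..<S}) s t n"
proof -
  let ?M = "lebesgue_on {0<..<S}"
  obtain \<sigma> \<theta> :: "real \<Rightarrow> real" where
    d\<sigma>: "\<And>x. (\<sigma> has_real_derivative \<theta> x) (at x)" and C\<theta>: "\<And>k. C_k k (\<lambda>x. complex_of_real (\<theta> x))"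
    and \<theta>_nonneg: "\<And>x. 0 \<le> \<theta> x" and \<theta>_supp: "\<And>x. x \<notin> {0..1} \<Longrightarrow> \<theta> x = 0"
    and \<sigma>0: "\<And>x. x \<le> 0 \<Longrightarrow> \<sigma> x = 0" and \<sigma>1: "\<And>x. 1 \<le> x \<Longrightarrow> \<sigma> x = 1" and \<sigma>_le: "\<And>x. \<bar>\<sigma> x\<bar> \<le> 1"
    using smooth_step_exists by blast
  \<comment> \<open>\<open>\<Sigma> k s\<close> climbs from 0 to 1 on [s, s + 1/(k+1)]; its
    derivative \<open>\<Theta> k s\<close> is a mollifier sitting to the right of
    \<open>s\<close>.\<close>
  define \<Sigma> where "\<Sigma> k s r = \<sigma> (real (Suc k) * (r - s))" for k s r
  define \<Theta> where "\<Theta> k s r = real (Suc k) * \<theta> (real (Suc k) * (r - s))" for k s r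
  have d\<Sigma>: "(\<Sigma> k s has_real_derivative \<Theta> k s r) (at r)" for k s r
    unfolding \<Sigma>_def[abs_def] \<Theta>_def
    by (rule DERIV_cong, rule DERIV_chain2[OF d\<sigma>]) (auto intro!: derivative_eq_intros)
  have cont\<theta>: "continuous_on UNIV \<theta>"
    using continuous_on_Re[OF C_k_imp_continuous[OF C\<theta>[of 0]]] by simp
  have C\<Theta>: "C_k j (\<lambda>r. complex_of_real (\<Theta> k s r))" for j k s
    using C_k_mult[OF C_k_const[of j "of_nat (Suc k)"] C_k_real_affine[OF C\<theta>[of j], of "real (Suc k)" "- (real (Suc k) * s)"]]
    by (simp add: \<Theta>_def algebra_simps)
  have cont\<Theta>: "continuous_on A (\<Theta> k s)" for A k s
    using continuous_on_subset[OF continuous_on_Re[OF C_k_imp_continuous[OF C\<Theta>[of 0 k s]]] subset_UNIV[of A]] by simp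
  have C\<Sigma>: "C_k j (\<lambda>r. complex_of_real (\<Sigma> k s r))" for j k s
    by (rule C_k_Suc_imp_C_k, rule C_k_SucI_vector_derivative[OF has_vector_derivative_of_real[OF d\<Sigma>] C\<Theta>])
  have int_mult: "integrable ?M (\<lambda>r. complex_of_real (\<Theta> k s r) * m r)" for k s
  proof -
    have "continuous_on {0..S} (\<lambda>r. complex_of_real (\<Theta> k s r) * m r)"
      by (intro continuous_on_mult continuous_on_of_real cont\<Theta> cont)
    from integrable_lebesgue_on_subset[OF continuous_imp_integrable_real[OF this]]
    show ?thesis
      by (auto simp: greaterThanLessThan_subseteq_atLeastAtMost_iff)
  qed
  have mollify: "(\<lambda>k. \<integral>r. complex_of_real (\<Theta> k s r) * m r \<partial>?M) \<longlonglongrightarrow> m s" if s: "0 < s" "s < S" for s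
  proof (rule LIMSEQ_I)
    fix \<epsilon> :: real
    assume \<epsilon>: "0 < \<epsilon>"
    have "continuous (at s within {0..S}) m"
      using cont s by (auto simp: continuous_on_eq_continuous_within)
    then obtain \<delta> where \<delta>: "0 < \<delta>" "\<And>r. r \<in> {0..S} \<Longrightarrow> dist r s < \<delta> \<Longrightarrow> dist (m r) (m s) < \<epsilon> / 2"
      using \<epsilon> by (auto simp: continuous_within_eps_delta dest: spec[of _ "\<epsilon> / 2"])
    \<comment> \<open>The bound \<delta> keeps the mollifier where \<open>m\<close> is close to
      \<open>m s\<close>; the bound \<open>S - s\<close> keeps its whole mass inside the
      interval.\<close>
    obtain N where N: "1 / real (Suc N) < min \<delta> (S - s)"
      using nat_approx_posE[of "min \<delta> (S - s)"] \<delta>(1) s by auto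
    have "norm ((\<integral>r. complex_of_real (\<Theta> k s r) * m r \<partial>?M) - m s) < \<epsilon>" if k: "N \<le> k" for k
    proof -
      have k': "1 / real (Suc k) < min \<delta> (S - s)"
        using N k by (smt (verit) frac_le of_nat_0_less_iff of_nat_mono zero_less_Suc Suc_le_mono)
      have I1: "integrable ?M (\<Theta> k s)" and "integral\<^sup>L ?M (\<Theta> k s) = integral {0..S} (\<Theta> k s)"
        using continuous_lebesgue_on_Ioo[OF cont\<Theta>] by auto
      moreover have "(\<Theta> k s has_integral \<Sigma> k s S - \<Sigma> k s 0) {0..S}"
        using s d\<Sigma> by (intro fundamental_theorem_of_calculus)
          (auto simp: has_real_derivative_iff_has_vector_derivative intro: has_vector_derivative_at_within)
      moreover have "\<Sigma> k s 0 = 0"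
        using s unfolding \<Sigma>_def by (intro \<sigma>0) (simp add: mult_nonneg_nonpos)
      moreover have "\<Sigma> k s S = 1"
        using k' unfolding \<Sigma>_def by (intro \<sigma>1) (simp add: field_simps)
      ultimately have I: "integral\<^sup>L ?M (\<Theta> k s) = 1"
        by (simp add: integral_unique)
      note I2 = int_mult[of k s]
      have "(\<integral>r. complex_of_real (\<Theta> k s r) * m r \<partial>?M) - m s =
          (\<integral>r. complex_of_real (\<Theta> k s r) * m r \<partial>?M) - (\<integral>r. complex_of_real (\<Theta> k s r) * m s \<partial>?M)"
        using I by (simp add: integral_complex_of_real)
      also have "\<dots> = (\<integral>r. complex_of_real (\<Theta> k s r) * (m r - m s) \<partial>?M)"
        using I1 I2 by (simp add: right_diff_distrib)
      also have "norm \<dots> \<le> (\<integral>r. \<Theta> k s r * (\<epsilon> / 2) \<partial>?M)"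
      proof (rule order_trans[OF integral_norm_bound integral_mono])
        show "integrable ?M (\<lambda>r. norm (complex_of_real (\<Theta> k s r) * (m r - m s)))"
          using I1 I2 by (simp only: right_diff_distrib) simp
        show "integrable ?M (\<lambda>r. \<Theta> k s r * (\<epsilon> / 2))"
          using I1 by simp
        fix r
        assume "r \<in> space ?M"
        then have r: "r \<in> {0..S}"
          by simp
        show "norm (complex_of_real (\<Theta> k s r) * (m r - m s)) \<le> \<Theta> k s r * (\<epsilon> / 2)"
        proof (cases "real (Suc k) * (r - s) \<in> {0..1}")
          case True
          then have "0 \<le> r - s" and "(r - s) * real (Suc k) \<le> 1"
            by (auto simp: zero_le_mult_iff mult.commute simp del: of_nat_Suc)
          then have "0 \<le> r - s" "r - s \<le> 1 / real (Suc k)"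
            by (simp_all add: pos_le_divide_eq del: of_nat_Suc)
          with k' have "dist r s < \<delta>"
            by (simp add: dist_real_def)
          from \<delta>(2)[OF r this] have "cmod (m r - m s) \<le> \<epsilon> / 2"
            by (simp add: dist_norm)
          moreover have "0 \<le> \<Theta> k s r"
            unfolding \<Theta>_def by (intro mult_nonneg_nonneg \<theta>_nonneg) simp
          ultimately show ?thesis
            by (simp only: norm_mult norm_of_real abs_of_nonneg mult_left_mono)
        next
          case False
          then show ?thesis
            by (simp add: \<Theta>_def \<theta>_supp)
        qed
      qed
      also have "\<dots> = \<epsilon> / 2"
        using I by simp
      finally show ?thesis
        using \<epsilon> by simp
    qed
    then show "\<exists>N. \<forall>k\<ge>N. norm ((\<integral>r. complex_of_real (\<Theta> k s r) * m r \<partial>?M) - m s) < \<epsilon>"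
      by blast
  qed
  have interior: "m t - m s = cut_integral ?M s t n" if st: "0 < s" "s \<le> t" "t < S" for s t
  proof -
    obtain N where N: "1 / real (Suc N) < S - t"
      using nat_approx_posE[of "S - t"] st by auto
    \<comment> \<open>The support lies in [s, t + 1/(k+1)], hence inside (0,S) once
      \<open>N \<le> k\<close>; this is why \<open>s\<close> and \<open>t\<close> are taken interior
      first. The form with \<open>(- 1) *\<close> fits the closure rules \<open>C_k_add\<close> and
      \<open>C_k_mult\<close>.\<close>
    define \<psi> where "\<psi> k r = complex_of_real (\<Sigma> k s r) + (- 1) * complex_of_real (\<Sigma> k t r)" for k r
    have test: "\<psi> k \<in> test_functions {0<..<S}" if k: "N \<le> k" for k
    proof -
      have k': "1 / real (Suc k) < S - t"
        using N k by (smt (verit) frac_le of_nat_0_less_iff of_nat_mono zero_less_Suc Suc_le_mono)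
      have "\<psi> k r = 0" if "r \<notin> {s..t + 1 / real (Suc k)}" for r
      proof (cases "r < s")
        case True
        with st show ?thesis
          by (simp add: \<psi>_def \<Sigma>_def \<sigma>0 mult_nonneg_nonpos)
      next
        case False
        with that have "t + 1 / real (Suc k) \<le> r"
          by auto
        then have "1 \<le> real (Suc k) * (r - t)"
          by (simp add: field_simps)
        moreover from this have "1 \<le> real (Suc k) * (r - s)"
          using st by (smt (verit) mult_left_mono of_nat_0_le_iff)
        ultimately show ?thesis
          by (simp add: \<psi>_def \<Sigma>_def \<sigma>1)
      qed
      then have "{r. \<psi> k r \<noteq> 0} \<subseteq> {s..t + 1 / real (Suc k)}"
        by blast
      then have sub: "closure {r. \<psi> k r \<noteq> 0} \<subseteq> {s..t + 1 / real (Suc k)}"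
        by (rule closure_minimal) simp
      then have "compact (closure {r. \<psi> k r \<noteq> 0})"
        using compact_Int_closed[OF compact_Icc closed_closure, of s "t + 1 / real (Suc k)" "{r. \<psi> k r \<noteq> 0}"]
        by (simp add: inf.absorb2)
      moreover have "{s..t + 1 / real (Suc k)} \<subseteq> {0<..<S}"
        using st k' by auto
      moreover have "C_k j (\<psi> k)" for j
        unfolding \<psi>_def[abs_def] by (intro C_k_add C_k_mult C_k_const C\<Sigma>)
      ultimately show ?thesis
        using sub by (auto simp: test_functions_def)
    qed
    have "partial_deriv 1 (\<psi> k) r = complex_of_real (\<Theta> k s r) - complex_of_real (\<Theta> k t r)" for k r
    proof (rule partial_deriv_1_eq)
      show "(\<psi> k has_vector_derivative complex_of_real (\<Theta> k s r) - complex_of_real (\<Theta> k t r)) (at r)"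
        unfolding \<psi>_def[abs_def] using has_vector_derivative_diff[OF has_vector_derivative_of_real[OF d\<Sigma>] has_vector_derivative_of_real[OF d\<Sigma>]]
        by simp
    qed
    then have "(\<integral>r. complex_of_real (\<Theta> k s r) * m r \<partial>?M) - (\<integral>r. complex_of_real (\<Theta> k t r) * m r \<partial>?M) =
        - (\<integral>r. \<psi> k r * n r \<partial>?M)" if "N \<le> k" for k
      using weak[OF test[OF that]] by (simp add: left_diff_distrib int_mult)
    then have "\<forall>\<^sub>F k in sequentially. (\<integral>r. complex_of_real (\<Theta> k s r) * m r \<partial>?M) - (\<integral>r. complex_of_real (\<Theta> k t r) * m r \<partial>?M) =
        - (\<integral>r. \<psi> k r * n r \<partial>?M)"
      by (auto simp: eventually_sequentially)
    moreover have "(\<lambda>k. (\<integral>r. complex_of_real (\<Theta> k s r) * m r \<partial>?M) - (\<integral>r. complex_of_real (\<Theta> k t r) * m r \<partial>?M)) \<longlonglongrightarrow> m s - m t"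
      using st by (intro tendsto_diff mollify) auto
    ultimately have "(\<lambda>k. - (\<integral>r. \<psi> k r * n r \<partial>?M)) \<longlonglongrightarrow> m s - m t"
      by (rule Lim_transform_eventually[rotated])
    moreover have "(\<lambda>k. - (\<integral>r. \<psi> k r * n r \<partial>?M)) \<longlonglongrightarrow> - cut_integral ?M s t n"
    proof (intro tendsto_minus integral_dominated_convergence)
      show "integrable ?M (\<lambda>r. 2 * norm (n r))"
        using int by simp
      \<comment> \<open>At \<open>r = q\<close> the step is still 0 for every \<open>k\<close>, so
        \<open>\<psi> k\<close> converges everywhere to the indicator of exactly the half-open
        interval.\<close>
      have step: "(\<lambda>k. complex_of_real (\<Sigma> k q r)) \<longlonglongrightarrow> (if q < r then 1 else 0)" for q r
      proof (cases "q < r")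
        case True
        obtain N where N: "1 / real (Suc N) < r - q"
          using nat_approx_posE[of "r - q"] True by auto
        have "\<Sigma> k q r = 1" if "N \<le> k" for k
        proof -
          have "1 / real (Suc k) < r - q"
            using N that by (smt (verit) frac_le of_nat_0_less_iff of_nat_mono zero_less_Suc Suc_le_mono)
          then show ?thesis
            unfolding \<Sigma>_def by (intro \<sigma>1) (simp add: field_simps)
        qed
        then show ?thesis
          using True by (intro tendsto_eventually) (auto simp: eventually_sequentially)
      next
        case False
        then show ?thesis
          by (simp add: \<Sigma>_def \<sigma>0 mult_nonneg_nonpos)
      qed
      have "(\<lambda>k. \<psi> k r) \<longlonglongrightarrow> of_real (indicator {s<..t} r)" for r
        using tendsto_add[OF step[of s r] tendsto_mult_left[OF step[of t r], of "-1"]] st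
        by (auto simp: \<psi>_def indicator_def split: if_splits)
      then show "AE r in ?M. (\<lambda>k. \<psi> k r * n r) \<longlonglongrightarrow> indicator {s<..t} r *\<^sub>R n r"
        by (auto simp: scaleR_conv_of_real intro!: tendsto_mult_right)
      show "AE r in ?M. norm (\<psi> k r * n r) \<le> 2 * norm (n r)" for k
      proof (rule AE_I2)
        fix r
        have "norm (\<psi> k r) \<le> \<bar>\<Sigma> k s r\<bar> + \<bar>\<Sigma> k t r\<bar>"
          unfolding \<psi>_def by (rule order_trans[OF norm_triangle_ineq]) simp
        also have "\<dots> \<le> 2"
          using \<sigma>_le[of "real (Suc k) * (r - s)"] \<sigma>_le[of "real (Suc k) * (r - t)"] unfolding \<Sigma>_def by linarith
        finally show "norm (\<psi> k r * n r) \<le> 2 * norm (n r)"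
          by (simp add: norm_mult mult_right_mono)
      qed
      show "(\<lambda>r. indicator {s<..t} r *\<^sub>R n r) \<in> borel_measurable ?M"
        by (rule borel_measurable_integrable[OF integrable_cut[OF int]])
      show "(\<lambda>r. \<psi> k r * n r) \<in> borel_measurable ?M" for k
      proof -
        have "continuous_on UNIV (\<psi> k)"
          unfolding \<psi>_def[abs_def] by (intro C_k_imp_continuous[of 0] C_k_add C_k_mult C_k_const C\<Sigma>)
        then have "\<psi> k \<in> borel_measurable ?M"
          by (intro measurable_restrict_space1 measurable_completion)
            (simp add: measurable_lborel1 borel_measurable_continuous_onI)
        then show ?thesis
          using borel_measurable_integrable[OF int] by measurable
      qed
    qed
    ultimately have "m s - m t = - cut_integral ?M s t n"
      by (rule LIMSEQ_unique)
    then show ?thesis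
      by (simp add: algebra_simps)
  qed
  \<comment> \<open>No test function reaches the endpoints. \<open>D\<close> is constant on the open
    interval and continuous on the closed one, which brings in 0 and \<open>S\<close>.\<close>
  define D where "D t = m t - cut_integral ?M 0 t n" for t
  have "continuous_on {0..S} D"
    unfolding D_def[abs_def] by (intro continuous_on_diff cont continuous_on_cut_integral[OF int]) simp
  have D_const: "D t = D s" if "0 < s" "s \<le> t" "t < S" for s t
    using interior[OF that] cut_integral_add[OF int, of 0 s t] that by (simp add: D_def algebra_simps)
  have "D t = D s"
  proof (cases "0 < S")
    case True
    then have cl: "closure {0<..<S} = {0..S}"
      by simp
    have D_cl: "D x = D (S / 2)" if "x \<in> closure {0<..<S}" for x
    proof (rule continuous_constant_on_closure[OF _ _ that])
      show "continuous_on (closure {0<..<S}) D"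
        using \<open>continuous_on {0..S} D\<close> cl by simp
      show "D y = D (S / 2)" if "y \<in> {0<..<S}" for y
        using that D_const[of y "S / 2"] D_const[of "S / 2" y] by (cases "y \<le> S / 2") auto
    qed
    show ?thesis
      using D_cl[of t] D_cl[of s] st unfolding cl by simp
  next
    case False
    with st have "s = t"
      by linarith
    then show ?thesis
      by simp
  qed
  then have "m t - m s = cut_integral ?M 0 t n - cut_integral ?M 0 s n"
    by (simp add: D_def algebra_simps)
  also have "\<dots> = cut_integral ?M s t n"
    using cut_integral_add[OF int, of 0 s t, symmetric] st by simp
  finally show ?thesis .
qed


section \<open>Square-integrable families of \<open>L\<^sup>2\<close> functions\<close>

text \<open>Joint measurability with square integrability is the input of Fubini. It passes to
  shorter time intervals and is easy to verify for products of a function of time and a function of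
  space.\<close>

definition L2_family :: "real \<Rightarrow> 'a::euclidean_space set \<Rightarrow> (real \<Rightarrow> 'a \<Rightarrow> complex) \<Rightarrow> bool" where
  "L2_family S \<Omega> u \<longleftrightarrow>
     (\<lambda>(t, x). u t x) \<in> borel_measurable (lebesgue_on {0<..<S} \<Otimes>\<^sub>M lebesgue_on \<Omega>) \<and>
     (AE t in lebesgue_on {0<..<S}. u t \<in> L2_space \<Omega>) \<and>
     integrable (lebesgue_on {0<..<S}) (\<lambda>t. (L2_norm \<Omega> (u t))\<^sup>2)"

lemma L2_time_imp_L2_family: "u \<in> L2_time S \<Omega> (L2_space \<Omega>) (L2_norm \<Omega>) \<Longrightarrow> L2_family S \<Omega> u"
  by (simp add: L2_time_def L2_family_def)

lemma finite_measure_lebesgue_on_Ioo: "finite_measure (lebesgue_on {0<..<S::real})"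
  by (rule finite_measure_lebesgue_on) (simp add: bounded_set_imp_lmeasurable)

lemma pair_sigma_finite_time_space:
  "\<Omega> \<in> lmeasurable \<Longrightarrow> pair_sigma_finite (lebesgue_on {0<..<S::real}) (lebesgue_on \<Omega>)"
  by (intro pair_sigma_finite.intro finite_measure.axioms(1) finite_measure_lebesgue_on_Ioo finite_measure_lebesgue_on)

lemma AE_lebesgue_on_subset:
  assumes "AE x in lebesgue_on T. P x" "S \<subseteq> T" "S \<in> sets lebesgue" "T \<in> sets lebesgue"
  shows "AE x in lebesgue_on S. P x"
proof -
  have "AE x in lebesgue. x \<in> T \<longrightarrow> P x"
    using assms by (simp add: AE_restrict_space_iff)
  then have "AE x in lebesgue. x \<in> S \<longrightarrow> P x"
    by (rule eventually_mono) (use assms(2) in blast)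
  then show ?thesis
    using assms by (simp add: AE_restrict_space_iff)
qed

text \<open>A forward solution lives up to \<open>T\<close>, a dual solution only up to its own
  final time; pairing them needs families over the same interval.\<close>

lemma L2_family_restrict:
  assumes u: "L2_family T \<Omega> u" and ST: "S \<le> T"
  shows "L2_family S \<Omega> u"
proof -
  have sub: "{0<..<S} \<subseteq> {0<..<T}"
    using ST by auto
  have "(\<lambda>z. (fst z, snd z)) \<in> lebesgue_on {0<..<S} \<Otimes>\<^sub>M lebesgue_on \<Omega> \<rightarrow>\<^sub>M lebesgue_on {0<..<T} \<Otimes>\<^sub>M lebesgue_on \<Omega>"
    using sub by (intro measurable_Pair measurable_compose[OF measurable_fst measurable_restrict_space3] measurable_snd) auto
  moreover have "(\<lambda>(t, x). u t x) \<in> borel_measurable (lebesgue_on {0<..<T} \<Otimes>\<^sub>M lebesgue_on \<Omega>)"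
    using u by (simp only: L2_family_def)
  ultimately have "(\<lambda>z. case (fst z, snd z) of (t, x) \<Rightarrow> u t x) \<in> borel_measurable (lebesgue_on {0<..<S} \<Otimes>\<^sub>M lebesgue_on \<Omega>)"
    by (rule measurable_compose)
  then have "(\<lambda>(t, x). u t x) \<in> borel_measurable (lebesgue_on {0<..<S} \<Otimes>\<^sub>M lebesgue_on \<Omega>)"
    by (simp only: prod.collapse)
  moreover have "AE t in lebesgue_on {0<..<S}. u t \<in> L2_space \<Omega>"
    by (rule AE_lebesgue_on_subset[OF _ sub]) (use u in \<open>simp_all add: L2_family_def\<close>)
  moreover have "integrable (lebesgue_on {0<..<S}) (\<lambda>t. (L2_norm \<Omega> (u t))\<^sup>2)"
    by (rule integrable_lebesgue_on_subset[OF _ sub]) (use u in \<open>simp_all add: L2_family_def\<close>)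
  ultimately show ?thesis
    by (simp add: L2_family_def)
qed

lemma L2_family_square_integrable:
  assumes u: "L2_family S \<Omega> u" and \<Omega>: "\<Omega> \<in> lmeasurable"
  shows "integrable (lebesgue_on {0<..<S} \<Otimes>\<^sub>M lebesgue_on \<Omega>) (\<lambda>(t, x). (cmod (u t x))\<^sup>2)"
proof -
  interpret pair_sigma_finite "lebesgue_on {0<..<S}" "lebesgue_on \<Omega>"
    by (rule pair_sigma_finite_time_space[OF \<Omega>])
  have [measurable]: "(\<lambda>(t, x). u t x) \<in> borel_measurable (lebesgue_on {0<..<S} \<Otimes>\<^sub>M lebesgue_on \<Omega>)"
    using u by (simp add: L2_family_def)
  have "integrable (lebesgue_on {0<..<S} \<Otimes>\<^sub>M lebesgue_on \<Omega>) (\<lambda>z. (cmod (case z of (t, x) \<Rightarrow> u t x))\<^sup>2)"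
  proof (rule Fubini_integrable)
    show "AE t in lebesgue_on {0<..<S}. integrable (lebesgue_on \<Omega>) (\<lambda>x. (cmod (case (t, x) of (t, x) \<Rightarrow> u t x))\<^sup>2)"
      using u by (auto simp: L2_family_def L2_space_def elim: eventually_mono)
    show "integrable (lebesgue_on {0<..<S}) (\<lambda>t. \<integral>x. norm ((cmod (case (t, x) of (t, x) \<Rightarrow> u t x))\<^sup>2) \<partial>lebesgue_on \<Omega>)"
      using u by (simp add: L2_family_def L2_norm_def)
  qed measurable
  then show ?thesis
    by (simp add: case_prod_beta')
qed

text \<open>The integrability half of Cauchy-Schwarz, applied to the product measure. The
  interchanges of time and space integrals below rest on it.\<close>

lemma L2_family_mult_integrable:
  assumes u: "L2_family S \<Omega> u" and v: "L2_family S \<Omega> v" and \<Omega>: "\<Omega> \<in> lmeasurable"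
  shows "integrable (lebesgue_on {0<..<S} \<Otimes>\<^sub>M lebesgue_on \<Omega>) (\<lambda>(t, x). u t x * v t x)"
  using integrable_mult_square_integrable[of "\<lambda>(t, x). u t x" "lebesgue_on {0<..<S} \<Otimes>\<^sub>M lebesgue_on \<Omega>" "\<lambda>(t, x). v t x"]
    u v L2_family_square_integrable[OF u \<Omega>] L2_family_square_integrable[OF v \<Omega>]
  by (simp add: L2_family_def case_prod_beta')

text \<open>With such a second factor, statements about pairs of families also cover weights in
  time, constant families (take \<beta> = 1) and the source \<open>g t * f x\<close>.\<close>

lemma L2_family_separated:
  fixes \<beta> :: "real \<Rightarrow> complex"
  assumes \<beta>: "continuous_on UNIV \<beta>" and p: "p \<in> L2_space \<Omega>"
  shows "L2_family S \<Omega> (\<lambda>t x. \<beta> t * p x)"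
proof -
  have [measurable]: "\<beta> \<in> borel_measurable (lebesgue_on {0<..<S})"
    using \<beta> by (intro measurable_restrict_space1 measurable_completion)
      (simp add: measurable_lborel1 borel_measurable_continuous_onI)
  note [measurable] = L2_spaceD(1)[OF p]
  have L2: "(\<lambda>x. c * p x) \<in> L2_space \<Omega>" for c
    using L2_spaceD[OF p] by (simp add: L2_space_def norm_mult power_mult_distrib)
  have N: "(L2_norm \<Omega> (\<lambda>x. c * p x))\<^sup>2 = (cmod c)\<^sup>2 * (\<integral>x. (cmod (p x))\<^sup>2 \<partial>lebesgue_on \<Omega>)" for c
    by (simp add: L2_norm_def norm_mult power_mult_distrib)
  have "continuous_on {0..S} (\<lambda>t. (cmod (\<beta> t))\<^sup>2)"
    by (intro continuous_intros continuous_on_subset[OF \<beta>]) simp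
  from continuous_lebesgue_on_Ioo(1)[OF this]
  have "integrable (lebesgue_on {0<..<S}) (\<lambda>t. (L2_norm \<Omega> (\<lambda>x. \<beta> t * p x))\<^sup>2)"
    unfolding N by (rule integrable_mult_left)
  then show ?thesis
    using L2 by (simp add: L2_family_def)
qed

lemma L2_family_norm_integrable:
  assumes "L2_family S \<Omega> u"
  shows "integrable (lebesgue_on {0<..<S}) (\<lambda>t. L2_norm \<Omega> (u t))"
proof -
  have int: "integrable (lebesgue_on {0<..<S}) (\<lambda>t. (L2_norm \<Omega> (u t))\<^sup>2)"
    using assms by (simp add: L2_family_def)
  \<comment> \<open>Measurability is given for the squared norm; the square root recovers it for the
    norm itself.\<close>
  from measurable_compose[OF borel_measurable_integrable[OF int] borel_measurable_sqrt]
  have "(\<lambda>t. L2_norm \<Omega> (u t)) \<in> borel_measurable (lebesgue_on {0<..<S})"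
    by simp
  from finite_measure.square_integrable_imp_integrable[OF finite_measure_lebesgue_on_Ioo this int]
  show ?thesis .
qed

lemma L2_family_pairing_integrable:
  assumes "L2_family S \<Omega> u" "L2_family S \<Omega> v" "\<Omega> \<in> lmeasurable"
  shows "integrable (lebesgue_on {0<..<S}) (\<lambda>t. \<integral>x. u t x * v t x \<partial>lebesgue_on \<Omega>)"
  using pair_sigma_finite.integrable_fst[OF pair_sigma_finite_time_space L2_family_mult_integrable] assms
  by blast

lemma L2_family_Fubini:
  assumes "L2_family S \<Omega> u" "L2_family S \<Omega> v" "\<Omega> \<in> lmeasurable"
  shows "(\<integral>x. (\<integral>t. u t x * v t x \<partial>lebesgue_on {0<..<S}) \<partial>lebesgue_on \<Omega>) =
    (\<integral>t. (\<integral>x. u t x * v t x \<partial>lebesgue_on \<Omega>) \<partial>lebesgue_on {0<..<S})"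
  using pair_sigma_finite.Fubini_integral[OF pair_sigma_finite_time_space L2_family_mult_integrable] assms
  by blast

section \<open>Weak time derivatives of pairings and the product rule\<close>

lemma continuous_into_L2_subset:
  "continuous_into_L2 T \<Omega> u \<Longrightarrow> S \<le> T \<Longrightarrow> continuous_into_L2 S \<Omega> u"
  unfolding continuous_into_L2_def by (auto intro!: tendsto_within_subset[of _ _ _ "{0..T}" "{0..S}"])

lemma continuous_on_L2_pairing:
  assumes u: "continuous_into_L2 S \<Omega> u" and p: "p \<in> L2_space \<Omega>"
  shows "continuous_on {0..S} (\<lambda>t. \<integral>x. u t x * p x \<partial>lebesgue_on \<Omega>)"
  unfolding continuous_on_def
proof
  fix s
  assume s: "s \<in> {0..S}"
  have "((\<lambda>t. \<integral>x. p x * u t x \<partial>lebesgue_on \<Omega>) \<longlongrightarrow> (\<integral>x. p x * u s x \<partial>lebesgue_on \<Omega>)) (at s within {0..S})"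
  proof (rule L2_pairing_tendsto[OF p])
    show "u s \<in> L2_space \<Omega>"
      using u s by (auto simp: continuous_into_L2_def)
    show "\<forall>\<^sub>F t in at s within {0..S}. u t \<in> L2_space \<Omega>"
      using u by (auto simp: continuous_into_L2_def eventually_at_filter)
    show "((\<lambda>t. L2_norm \<Omega> (\<lambda>x. u s x - u t x)) \<longlongrightarrow> 0) (at s within {0..S})"
      using u s unfolding continuous_into_L2_def by (subst L2_norm_minus_commute) blast
  qed
  then show "((\<lambda>t. \<integral>x. u t x * p x \<partial>lebesgue_on \<Omega>) \<longlongrightarrow> (\<integral>x. u s x * p x \<partial>lebesgue_on \<Omega>)) (at s within {0..S})"
    by (simp add: mult.commute)
qed

lemma integral_test_function_mult_restrict:
  fixes h :: "real \<Rightarrow> complex"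
  assumes \<psi>: "\<psi> \<in> test_functions {0<..<S}" and ST: "S \<le> T"
  shows "(\<integral>r. \<psi> r * h r \<partial>lebesgue_on {0<..<S}) = (\<integral>r. \<psi> r * h r \<partial>lebesgue_on {0<..<T})"
proof -
  have z: "\<psi> r * h r = 0" if "r \<notin> {0<..<S}" for r
    using test_functionsD(4)[OF \<psi> that] by simp
  have z': "\<psi> r * h r = 0" if "r \<notin> {0<..<T}" for r
  proof (rule z)
    show "r \<notin> {0<..<S}"
      using that ST by auto
  qed
  show ?thesis
    using integral_restrict_support[of "{0<..<S}", OF _ z] integral_restrict_support[of "{0<..<T}", OF _ z'] by simp
qed

text \<open>The exceptional null set in \<open>is_time_deriv\<close> depends on the test function.
  Integrating against \<open>p\<close> in space absorbs it, and exchanging the integrals leaves a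
  scalar weak derivative, to which \<open>weak_derivative_cut_integral\<close> applies.\<close>

lemma time_deriv_pairing:
  assumes d: "is_time_deriv T \<Omega> u w" and cont: "continuous_into_L2 T \<Omega> u"
    and \<Omega>: "\<Omega> \<in> lmeasurable" and p: "p \<in> L2_space \<Omega>"
    and st: "0 \<le> s" "s \<le> t" "t \<le> S" and ST: "S \<le> T"
  shows "(\<integral>x. u t x * p x \<partial>lebesgue_on \<Omega>) - (\<integral>x. u s x * p x \<partial>lebesgue_on \<Omega>) =
    cut_integral (lebesgue_on {0<..<S}) s t (\<lambda>r. \<integral>x. w r x * p x \<partial>lebesgue_on \<Omega>)"
proof (rule weak_derivative_cut_integral[OF _ _ _ st])
  have uf: "L2_family T \<Omega> u" and wf: "L2_family T \<Omega> w"
    using d by (auto simp: is_time_deriv_def intro: L2_time_imp_L2_family)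
  have pf: "L2_family S' \<Omega> (\<lambda>_. p)" for S'
    using L2_family_separated[OF _ p, of "\<lambda>_. 1"] by simp
  show "continuous_on {0..S} (\<lambda>t. \<integral>x. u t x * p x \<partial>lebesgue_on \<Omega>)"
    by (rule continuous_on_L2_pairing[OF continuous_into_L2_subset[OF cont ST] p])
  show "integrable (lebesgue_on {0<..<S}) (\<lambda>r. \<integral>x. w r x * p x \<partial>lebesgue_on \<Omega>)"
    by (rule L2_family_pairing_integrable[OF L2_family_restrict[OF wf ST] pf \<Omega>])
  fix \<psi>
  assume \<psi>: "\<psi> \<in> test_functions {0<..<S}"
  have \<psi>': "partial_deriv 1 \<psi> \<in> test_functions {0<..<S}"
    by (rule partial_deriv_test_function[OF \<psi>]) simp
  \<comment> \<open>The weak derivative of \<open>u\<close> is tested on (0,T), so \<psi> is viewed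
    there; by its support the integrals over (0,S) and (0,T) agree.\<close>
  have \<psi>T: "\<psi> \<in> test_functions {0<..<T}"
    using \<psi> ST by (fastforce simp: test_functions_def)
  have swap: "(\<integral>r. \<beta> r * (\<integral>x. h r x * p x \<partial>lebesgue_on \<Omega>) \<partial>lebesgue_on {0<..<T}) =
      (\<integral>x. (\<integral>r. \<beta> r * h r x \<partial>lebesgue_on {0<..<T}) * p x \<partial>lebesgue_on \<Omega>)"
    if h: "L2_family T \<Omega> h" and \<beta>: "continuous_on UNIV \<beta>" for h and \<beta> :: "real \<Rightarrow> complex"
  proof -
    have "(\<integral>x. (\<integral>r. h r x * (\<beta> r * p x) \<partial>lebesgue_on {0<..<T}) \<partial>lebesgue_on \<Omega>) =
        (\<integral>r. (\<integral>x. h r x * (\<beta> r * p x) \<partial>lebesgue_on \<Omega>) \<partial>lebesgue_on {0<..<T})"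
      by (rule L2_family_Fubini[OF h L2_family_separated[OF \<beta> p] \<Omega>])
    moreover have "(\<integral>r. h r x * (\<beta> r * p x) \<partial>lebesgue_on {0<..<T}) = (\<integral>r. \<beta> r * h r x \<partial>lebesgue_on {0<..<T}) * p x" for x
      by (subst integral_mult_left_zero[symmetric]) (simp add: ac_simps)
    moreover have "(\<integral>x. h r x * (\<beta> r * p x) \<partial>lebesgue_on \<Omega>) = \<beta> r * (\<integral>x. h r x * p x \<partial>lebesgue_on \<Omega>)" for r
      by (subst integral_mult_right_zero[symmetric]) (simp add: ac_simps)
    ultimately show ?thesis
      by simp
  qed
  have meas: "(\<lambda>x. \<integral>r. \<beta> r * h r x \<partial>lebesgue_on {0<..<T}) \<in> borel_measurable (lebesgue_on \<Omega>)"
    if h: "L2_family T \<Omega> h" and \<beta>: "continuous_on UNIV \<beta>" for h and \<beta> :: "real \<Rightarrow> complex"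
  proof -
    \<comment> \<open>The constant 1 is square integrable since \<Omega> has finite measure. It
      exhibits the time integral as a marginal of a jointly integrable function, hence as measurable
      in \<open>x\<close>.\<close>
    have one: "(\<lambda>_. 1) \<in> L2_space \<Omega>"
      using finite_measure.integrable_const[OF finite_measure_lebesgue_on[OF \<Omega>]] by (simp add: L2_space_def)
    from pair_sigma_finite.integrable_snd[OF pair_sigma_finite_time_space[OF \<Omega>]
        L2_family_mult_integrable[OF L2_family_separated[OF \<beta> one] h \<Omega>]]
    show ?thesis
      by (simp add: borel_measurable_integrable)
  qed
  have "(\<integral>r. partial_deriv 1 \<psi> r * (\<integral>x. u r x * p x \<partial>lebesgue_on \<Omega>) \<partial>lebesgue_on {0<..<S}) =
      (\<integral>x. (\<integral>r. partial_deriv 1 \<psi> r * u r x \<partial>lebesgue_on {0<..<T}) * p x \<partial>lebesgue_on \<Omega>)"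
    unfolding integral_test_function_mult_restrict[OF \<psi>' ST]
    by (rule swap[OF uf test_functionsD(2)[OF \<psi>']])
  also have "\<dots> = (\<integral>x. - (\<integral>r. \<psi> r * w r x \<partial>lebesgue_on {0<..<T}) * p x \<partial>lebesgue_on \<Omega>)"
  proof (rule integral_cong_AE)
    have "AE x in lebesgue_on \<Omega>. (\<integral>r. partial_deriv 1 \<psi> r * u r x \<partial>lebesgue_on {0<..<T}) =
        - (\<integral>r. \<psi> r * w r x \<partial>lebesgue_on {0<..<T})"
      using d \<psi>T by (simp add: is_time_deriv_def)
    then show "AE x in lebesgue_on \<Omega>. (\<integral>r. partial_deriv 1 \<psi> r * u r x \<partial>lebesgue_on {0<..<T}) * p x =
        - (\<integral>r. \<psi> r * w r x \<partial>lebesgue_on {0<..<T}) * p x"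
      by (rule eventually_mono) simp
  qed (intro borel_measurable_times borel_measurable_uminus L2_spaceD(1)[OF p]
      meas[OF uf test_functionsD(2)[OF \<psi>']] meas[OF wf test_functionsD(2)[OF \<psi>]])+
  also have "\<dots> = - (\<integral>x. (\<integral>r. \<psi> r * w r x \<partial>lebesgue_on {0<..<T}) * p x \<partial>lebesgue_on \<Omega>)"
    by simp
  also have "(\<integral>x. (\<integral>r. \<psi> r * w r x \<partial>lebesgue_on {0<..<T}) * p x \<partial>lebesgue_on \<Omega>) =
      (\<integral>r. \<psi> r * (\<integral>x. w r x * p x \<partial>lebesgue_on \<Omega>) \<partial>lebesgue_on {0<..<S})"
    unfolding integral_test_function_mult_restrict[OF \<psi> ST]
    by (rule swap[OF wf test_functionsD(2)[OF \<psi>], symmetric])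
  finally show "(\<integral>r. partial_deriv 1 \<psi> r * (\<integral>x. u r x * p x \<partial>lebesgue_on \<Omega>) \<partial>lebesgue_on {0<..<S}) =
      - (\<integral>r. \<psi> r * (\<integral>x. w r x * p x \<partial>lebesgue_on \<Omega>) \<partial>lebesgue_on {0<..<S})" .
qed

text \<open>
  Over a short interval around \<open>x\<close> the increment of the pairing differs from the integral of the
  claimed derivative by at most \<open>2\<epsilon>\<close> times the integral of the norms of \<open>w\<close> and \<open>z\<close>. This estimate
  is additive, so it extends to \<open>[0,S]\<close> by bisection.
\<close>

lemma pairing_product_rule:
  assumes \<Omega>: "\<Omega> \<in> lmeasurable" and S: "0 \<le> S"
    and cu: "continuous_into_L2 S \<Omega> u" and cv: "continuous_into_L2 S \<Omega> v"
    and fam: "L2_family S \<Omega> u" "L2_family S \<Omega> v" "L2_family S \<Omega> w" "L2_family S \<Omega> z"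
    and du: "\<And>p s t. p \<in> L2_space \<Omega> \<Longrightarrow> 0 \<le> s \<Longrightarrow> s \<le> t \<Longrightarrow> t \<le> S \<Longrightarrow>
      (\<integral>x. u t x * p x \<partial>lebesgue_on \<Omega>) - (\<integral>x. u s x * p x \<partial>lebesgue_on \<Omega>) =
      cut_integral (lebesgue_on {0<..<S}) s t (\<lambda>r. \<integral>x. w r x * p x \<partial>lebesgue_on \<Omega>)"
    and dv: "\<And>p s t. p \<in> L2_space \<Omega> \<Longrightarrow> 0 \<le> s \<Longrightarrow> s \<le> t \<Longrightarrow> t \<le> S \<Longrightarrow>
      (\<integral>x. v t x * p x \<partial>lebesgue_on \<Omega>) - (\<integral>x. v s x * p x \<partial>lebesgue_on \<Omega>) =
      cut_integral (lebesgue_on {0<..<S}) s t (\<lambda>r. \<integral>x. z r x * p x \<partial>lebesgue_on \<Omega>)"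
  shows "(\<integral>x. u S x * v S x \<partial>lebesgue_on \<Omega>) - (\<integral>x. u 0 x * v 0 x \<partial>lebesgue_on \<Omega>) =
    (\<integral>r. (\<integral>x. w r x * v r x \<partial>lebesgue_on \<Omega>) + (\<integral>x. u r x * z r x \<partial>lebesgue_on \<Omega>) \<partial>lebesgue_on {0<..<S})"
proof -
  let ?M = "lebesgue_on {0<..<S}"
  define B where "B f h = (\<integral>x. f x * h x \<partial>lebesgue_on \<Omega>)" for f h :: "'a \<Rightarrow> complex"
  define G where "G r = B (w r) (v r) + B (u r) (z r)" for r
  define N where "N r = L2_norm \<Omega> (w r) + L2_norm \<Omega> (z r)" for r
  \<comment> \<open>The defect of the product rule on [s,t], additive over adjacent intervals; the
    goal is \<open>D 0 S = 0\<close>.\<close>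
  define D where "D s t = B (u t) (v t) - B (u s) (v s) - cut_integral ?M s t G" for s t
  have B_int: "integrable ?M (\<lambda>r. B (f r) (h r))" if "L2_family S \<Omega> f" "L2_family S \<Omega> h" for f h
    unfolding B_def by (rule L2_family_pairing_integrable[OF that \<Omega>])
  have const: "L2_family S \<Omega> (\<lambda>_. p)" if "p \<in> L2_space \<Omega>" for p
    using L2_family_separated[OF _ that, of "\<lambda>_. 1"] by simp
  have G_int: "integrable ?M G"
    unfolding G_def[abs_def] by (intro Bochner_Integration.integrable_add B_int fam)
  have N_int: "integrable ?M N"
    unfolding N_def[abs_def] by (intro Bochner_Integration.integrable_add L2_family_norm_integrable fam)
  have uL2: "u r \<in> L2_space \<Omega>" and vL2: "v r \<in> L2_space \<Omega>" if "r \<in> {0..S}" for r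
    using cu cv that by (auto simp: continuous_into_L2_def)
  have D_add: "D s q = D s t + D t q" if "s \<le> t" "t \<le> q" for s t q
    using cut_integral_add[OF G_int that] by (simp add: D_def algebra_simps)
  have close: "\<exists>d>0. \<forall>r\<in>{0..S}. \<bar>r - x\<bar> < d \<longrightarrow> L2_norm \<Omega> (\<lambda>y. f r y - f x y) \<le> \<epsilon>"
    if f: "continuous_into_L2 S \<Omega> f" and x: "x \<in> {0..S}" and \<epsilon>: "0 < \<epsilon>" for f x and \<epsilon> :: real
  proof -
    have "((\<lambda>t. L2_norm \<Omega> (\<lambda>y. f t y - f x y)) \<longlongrightarrow> 0) (at x within {0..S})"
      using f x by (auto simp: continuous_into_L2_def)
    from tendstoD[OF this \<epsilon>] obtain d where d: "0 < d"
      "\<And>r. r \<in> {0..S} \<Longrightarrow> r \<noteq> x \<Longrightarrow> dist r x < d \<Longrightarrow> dist (L2_norm \<Omega> (\<lambda>y. f r y - f x y)) 0 < \<epsilon>"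
      unfolding eventually_at by blast
    have "L2_norm \<Omega> (\<lambda>y. f r y - f x y) \<le> \<epsilon>" if "r \<in> {0..S}" "\<bar>r - x\<bar> < d" for r
    proof (cases "r = x")
      case True
      then show ?thesis
        using \<epsilon> by (simp add: L2_norm_def)
    next
      case False
      then show ?thesis
        using d(2)[OF that(1) False] that(2) by (simp add: dist_real_def)
    qed
    with d(1) show ?thesis
      by blast
  qed
  have est: "cmod (D 0 S) \<le> 2 * \<epsilon> * cut_integral ?M 0 S N" if \<epsilon>: "0 < \<epsilon>" for \<epsilon> :: real
  proof -
    \<comment> \<open>The premises inside \<open>P\<close> are needed because \<open>Bolzano\<close>
      asks for all short intervals around a point, including those that stick out of [0,S].\<close>
    define P where "P s t \<longleftrightarrow> (0 \<le> s \<longrightarrow> t \<le> S \<longrightarrow> cmod (D s t) \<le> 2 * \<epsilon> * cut_integral ?M s t N)" for s t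
    have "P 0 S"
    proof (rule Bolzano[OF S])
      fix s t q
      assume trans: "P s t" "P t q" "s \<le> t" "t \<le> q"
      show "P s q"
        unfolding P_def
      proof (intro impI)
        assume "0 \<le> s" "q \<le> S"
        with trans(1)[unfolded P_def] trans(2)[unfolded P_def] trans(3,4) have "cmod (D s t) + cmod (D t q) \<le> 2 * \<epsilon> * cut_integral ?M s t N + 2 * \<epsilon> * cut_integral ?M t q N"
          by (intro add_mono) auto
        also have "\<dots> = 2 * \<epsilon> * cut_integral ?M s q N"
          using cut_integral_add[OF N_int trans(3,4)] by (simp only: distrib_left[symmetric])
        finally show "cmod (D s q) \<le> 2 * \<epsilon> * cut_integral ?M s q N"
          using D_add[of s t q] trans norm_triangle_ineq[of "D s t" "D t q"] by simp
      qed
    next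
      fix x
      assume "0 \<le> x" "x \<le> S"
      then have x: "x \<in> {0..S}"
        by simp
      obtain d1 where d1: "0 < d1" "\<And>r. r \<in> {0..S} \<Longrightarrow> \<bar>r - x\<bar> < d1 \<Longrightarrow> L2_norm \<Omega> (\<lambda>y. u r y - u x y) \<le> \<epsilon>"
        using close[OF cu x \<epsilon>] by blast
      obtain d2 where d2: "0 < d2" "\<And>r. r \<in> {0..S} \<Longrightarrow> \<bar>r - x\<bar> < d2 \<Longrightarrow> L2_norm \<Omega> (\<lambda>y. v r y - v x y) \<le> \<epsilon>"
        using close[OF cv x \<epsilon>] by blast
      have "cmod (D s t) \<le> 2 * \<epsilon> * cut_integral ?M s t N"
        if sx: "s \<le> x" and xt: "x \<le> t" and st: "t - s < min d1 d2" and s0: "0 \<le> s" and tS: "t \<le> S" for s t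
      proof -
        have sI: "s \<in> {0..S}" and tI: "t \<in> {0..S}" and s_le_t: "s \<le> t"
          using sx xt s0 tS by auto
        \<comment> \<open>The increment is split at \<open>B (u s) (v t)\<close>, so that each part
          has one frozen factor and \<open>du\<close> or \<open>dv\<close> applies.\<close>
        have "B (u t) (v t) - B (u s) (v t) = cut_integral ?M s t (\<lambda>r. B (w r) (v t))"
          unfolding B_def by (rule du[OF vL2[OF tI] s0 s_le_t tS])
        moreover have "B (u s) (v t) - B (u s) (v s) = cut_integral ?M s t (\<lambda>r. B (z r) (u s))"
          unfolding B_def using dv[OF uL2[OF sI] s0 s_le_t tS] by (simp add: mult.commute)
        ultimately have "D s t = cut_integral ?M s t (\<lambda>r. B (w r) (v t)) + cut_integral ?M s t (\<lambda>r. B (z r) (u s)) - cut_integral ?M s t G"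
          by (simp add: D_def algebra_simps)
        also have "\<dots> = cut_integral ?M s t (\<lambda>r. B (w r) (v t) + B (z r) (u s) - G r)"
          using integrable_cut[OF B_int[OF fam(3) const[OF vL2[OF tI]]]] integrable_cut[OF B_int[OF fam(4) const[OF uL2[OF sI]]]]
            integrable_cut[OF G_int]
          by (simp add: scaleR_add_right scaleR_diff_right)
        also have "cmod \<dots> \<le> (\<integral>r. indicator {s<..t} r *\<^sub>R (2 * \<epsilon> * N r) \<partial>?M)"
        proof (rule order_trans[OF integral_norm_bound integral_mono_AE])
          show "integrable ?M (\<lambda>r. cmod (indicator {s<..t} r *\<^sub>R (B (w r) (v t) + B (z r) (u s) - G r)))"
            by (intro integrable_norm integrable_cut Bochner_Integration.integrable_add Bochner_Integration.integrable_diff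
                B_int fam const vL2 uL2 sI tI G_int)
          show "integrable ?M (\<lambda>r. indicator {s<..t} r *\<^sub>R (2 * \<epsilon> * N r))"
            by (intro integrable_cut integrable_mult_right N_int)
          have "AE r in ?M. w r \<in> L2_space \<Omega>" "AE r in ?M. z r \<in> L2_space \<Omega>"
            using fam by (auto simp: L2_family_def)
          then show "AE r in ?M. cmod (indicator {s<..t} r *\<^sub>R (B (w r) (v t) + B (z r) (u s) - G r)) \<le> indicator {s<..t} r *\<^sub>R (2 * \<epsilon> * N r)"
            using AE_space
          proof eventually_elim
            case (elim r)
            show ?case
            proof (cases "r \<in> {s<..t}")
              case True
              have rI: "r \<in> {0..S}"
                using elim by simp
              have near: "\<bar>r - x\<bar> < d1" "\<bar>r - x\<bar> < d2" "\<bar>s - x\<bar> < d1" "\<bar>t - x\<bar> < d2"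
                using True sx xt st by auto
              note L2 = elim(1,2) uL2[OF rI] vL2[OF rI] uL2[OF sI] vL2[OF tI] uL2[OF x] vL2[OF x]
              have bound: "cmod (B p q) \<le> L2_norm \<Omega> p * \<epsilon>"
                if "p \<in> L2_space \<Omega>" "q \<in> L2_space \<Omega>" "L2_norm \<Omega> q \<le> \<epsilon>" for p q
                unfolding B_def
                by (rule order_trans[OF L2_Cauchy_Schwarz[OF that(1,2)] mult_left_mono[OF that(3)]]) simp
              have diff: "B p (\<lambda>y. q y - q' y) = B p q - B p q'"
                if "p \<in> L2_space \<Omega>" "q \<in> L2_space \<Omega>" "q' \<in> L2_space \<Omega>" for p q q'
                unfolding B_def by (rule L2_pairing_diff_right[OF that])
              have "B (w r) (v t) + B (z r) (u s) - G r =
                  (B (w r) (\<lambda>y. v t y - v x y) - B (w r) (\<lambda>y. v r y - v x y)) +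
                  (B (z r) (\<lambda>y. u s y - u x y) - B (z r) (\<lambda>y. u r y - u x y))"
                using L2 by (simp add: diff G_def) (simp add: B_def mult.commute)
              also have "cmod \<dots> \<le> (L2_norm \<Omega> (w r) * \<epsilon> + L2_norm \<Omega> (w r) * \<epsilon>) + (L2_norm \<Omega> (z r) * \<epsilon> + L2_norm \<Omega> (z r) * \<epsilon>)"
                using L2 near d1(2)[OF rI] d1(2)[OF sI] d2(2)[OF rI] d2(2)[OF tI]
                by (intro order_trans[OF norm_triangle_ineq] add_mono order_trans[OF norm_triangle_ineq4] bound L2_space_diff) auto
              also have "\<dots> = 2 * \<epsilon> * N r"
                by (simp add: N_def algebra_simps)
              finally show ?thesis
                using True by simp
            qed simp
          qed
        qed
        also have "\<dots> = 2 * \<epsilon> * cut_integral ?M s t N"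
          by (subst integral_mult_right_zero[symmetric]) (simp add: ac_simps)
        finally show ?thesis .
      qed
      then show "\<exists>d>0. \<forall>s t. s \<le> x \<and> x \<le> t \<and> t - s < d \<longrightarrow> P s t"
        using d1(1) d2(1) unfolding P_def by (intro exI[of _ "min d1 d2"]) simp
    qed
    then show ?thesis
      by (simp add: P_def)
  qed
  have "cmod (D 0 S) \<le> 0"
  proof (rule field_le_epsilon)
    fix \<eta> :: real
    assume \<eta>: "0 < \<eta>"
    let ?c = "cut_integral ?M 0 S N"
    have c: "0 \<le> ?c"
      by (intro Bochner_Integration.integral_nonneg) (simp add: N_def)
    \<comment> \<open>This choice of \<epsilon> brings the bound below \<eta>; the added 1 covers
      the case that \<open>?c\<close> is 0.\<close>
    have "cmod (D 0 S) \<le> 2 * (\<eta> / (2 * (?c + 1))) * ?c"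
      using c \<eta> by (intro est) simp
    also have "\<dots> = \<eta> * (?c / (?c + 1))"
      using c by (simp add: field_simps)
    also have "\<dots> \<le> \<eta> * 1"
      using c \<eta> by (intro mult_left_mono) (simp_all add: divide_le_eq_1)
    finally show "cmod (D 0 S) \<le> 0 + \<eta>"
      by simp
  qed
  \<comment> \<open>The indicator of (0,S] equals 1 on all of (0,S).\<close>
  moreover have "cut_integral ?M 0 S G = integral\<^sup>L ?M G"
    by (intro Bochner_Integration.integral_cong) auto
  ultimately show ?thesis
    by (simp add: D_def B_def G_def[abs_def])
qed


section \<open>Duality between the forward and the backward problem\<close>

lemma is_time_deriv_time_deriv: "u \<in> H1_time T \<Omega> \<Longrightarrow> is_time_deriv T \<Omega> u (time_deriv T \<Omega> u)"
  unfolding time_deriv_def by (rule someI_ex[of "is_time_deriv T \<Omega> u"]) (simp add: H1_time_def)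

lemma solution_spaceD:
  assumes "u \<in> solution_space T \<Omega>"
  shows "is_time_deriv T \<Omega> u (time_deriv T \<Omega> u)" "continuous_into_L2 T \<Omega> u"
    "L2_family T \<Omega> u" "L2_family T \<Omega> (time_deriv T \<Omega> u)"
    "AE t in lebesgue_on {0<..<T}. u t \<in> H10_space \<Omega> \<inter> H2_space \<Omega>"
proof -
  show d: "is_time_deriv T \<Omega> u (time_deriv T \<Omega> u)"
    using assms by (intro is_time_deriv_time_deriv) (simp add: solution_space_def)
  then show "L2_family T \<Omega> u" "L2_family T \<Omega> (time_deriv T \<Omega> u)"
    by (auto simp: is_time_deriv_def intro: L2_time_imp_L2_family)
  show "continuous_into_L2 T \<Omega> u" "AE t in lebesgue_on {0<..<T}. u t \<in> H10_space \<Omega> \<inter> H2_space \<Omega>"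
    using assms by (simp_all add: solution_space_def L2_time_def)
qed

lemma L2_pairing_cong_AE:
  assumes "AE x in lebesgue_on \<Omega>. f x = f' x" "AE x in lebesgue_on \<Omega>. h x = h' x"
    and "f \<in> L2_space \<Omega>" "f' \<in> L2_space \<Omega>" "h \<in> L2_space \<Omega>" "h' \<in> L2_space \<Omega>"
  shows "(\<integral>x. f x * h x \<partial>lebesgue_on \<Omega>) = (\<integral>x. f' x * h' x \<partial>lebesgue_on \<Omega>)"
proof (rule integral_cong_AE)
  show "AE x in lebesgue_on \<Omega>. f x * h x = f' x * h' x"
    using assms(1,2) by eventually_elim simp
qed (intro borel_measurable_times L2_spaceD(1) assms)+

text \<open>The identity at a single time, with the opposite signs of \<open>c\<close> in the two
  equations cancelling. The source is grouped as \<open>v x * (\<beta> * f x)\<close> so that it is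
  later a pairing of two families, \<open>v\<close> and the separated source.\<close>

lemma forward_dual_pairing_derivative:
  assumes eig: "dirichlet_eigensystem \<Omega> ev e" and \<Omega>: "\<Omega> \<in> sets lebesgue"
    and u: "u \<in> H10_space \<Omega> \<inter> H2_space \<Omega>" and v: "v \<in> H10_space \<Omega> \<inter> H2_space \<Omega>"
    and L2: "w \<in> L2_space \<Omega>" "z \<in> L2_space \<Omega>" "f \<in> L2_space \<Omega>"
    and eq_u: "AE x in lebesgue_on \<Omega>. w x - c * laplacian \<Omega> u x = \<beta> * f x"
    and eq_v: "AE x in lebesgue_on \<Omega>. z x + c * laplacian \<Omega> v x = 0"
  shows "(\<integral>x. w x * v x \<partial>lebesgue_on \<Omega>) + (\<integral>x. u x * z x \<partial>lebesgue_on \<Omega>) = (\<integral>x. v x * (\<beta> * f x) \<partial>lebesgue_on \<Omega>)"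
proof -
  have uL2: "u \<in> L2_space \<Omega>" and vL2: "v \<in> L2_space \<Omega>"
    using u v by (auto simp: H10_space_def H1_space_def)
  have int1: "integrable (lebesgue_on \<Omega>) (\<lambda>x. laplacian \<Omega> u x * v x)"
    using u v by (intro laplacian_pairing(2)[OF eig \<Omega>]) auto
  have int2: "integrable (lebesgue_on \<Omega>) (\<lambda>x. laplacian \<Omega> v x * u x)"
    using u v by (intro laplacian_pairing(2)[OF eig \<Omega>]) auto
  have intf: "integrable (lebesgue_on \<Omega>) (\<lambda>x. v x * (\<beta> * f x))"
    using integrable_mult_right[OF L2_integrable_mult[OF vL2 L2(3)], of \<beta>] by (simp add: ac_simps)
  have "(\<integral>x. w x * v x \<partial>lebesgue_on \<Omega>) = (\<integral>x. c * (laplacian \<Omega> u x * v x) + v x * (\<beta> * f x) \<partial>lebesgue_on \<Omega>)"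
  proof (rule integral_cong_AE)
    show "AE x in lebesgue_on \<Omega>. w x * v x = c * (laplacian \<Omega> u x * v x) + v x * (\<beta> * f x)"
      using eq_u
    proof eventually_elim
      case (elim x)
      then have "w x = c * laplacian \<Omega> u x + \<beta> * f x"
        by (simp add: algebra_simps)
      then show ?case
        by (simp add: algebra_simps)
    qed
    show "(\<lambda>x. w x * v x) \<in> borel_measurable (lebesgue_on \<Omega>)"
      using L2_integrable_mult[OF L2(1) vL2] by (rule borel_measurable_integrable)
    show "(\<lambda>x. c * (laplacian \<Omega> u x * v x) + v x * (\<beta> * f x)) \<in> borel_measurable (lebesgue_on \<Omega>)"
      using int1 intf by (intro borel_measurable_integrable Bochner_Integration.integrable_add integrable_mult_right)
  qed
  also have "\<dots> = c * (\<integral>x. laplacian \<Omega> u x * v x \<partial>lebesgue_on \<Omega>) + (\<integral>x. v x * (\<beta> * f x) \<partial>lebesgue_on \<Omega>)"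
    using int1 intf by simp
  finally have 1: "(\<integral>x. w x * v x \<partial>lebesgue_on \<Omega>) =
      c * (\<integral>x. laplacian \<Omega> u x * v x \<partial>lebesgue_on \<Omega>) + (\<integral>x. v x * (\<beta> * f x) \<partial>lebesgue_on \<Omega>)" .
  have "(\<integral>x. u x * z x \<partial>lebesgue_on \<Omega>) = (\<integral>x. - c * (laplacian \<Omega> v x * u x) \<partial>lebesgue_on \<Omega>)"
  proof (rule integral_cong_AE)
    show "AE x in lebesgue_on \<Omega>. u x * z x = - c * (laplacian \<Omega> v x * u x)"
      using eq_v
    proof eventually_elim
      case (elim x)
      then have "z x = - c * laplacian \<Omega> v x"
        by (simp add: eq_neg_iff_add_eq_0)
      then show ?case
        by simp
    qed
    show "(\<lambda>x. u x * z x) \<in> borel_measurable (lebesgue_on \<Omega>)"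
      using L2_integrable_mult[OF uL2 L2(2)] by (rule borel_measurable_integrable)
    show "(\<lambda>x. - c * (laplacian \<Omega> v x * u x)) \<in> borel_measurable (lebesgue_on \<Omega>)"
      using int2 by (intro borel_measurable_integrable integrable_mult_right)
  qed
  also have "\<dots> = - c * (\<integral>x. u x * laplacian \<Omega> v x \<partial>lebesgue_on \<Omega>)"
    by (simp only: integral_mult_right_zero mult.commute)
  also have "\<dots> = - c * (\<integral>x. laplacian \<Omega> u x * v x \<partial>lebesgue_on \<Omega>)"
    using laplacian_symmetric[OF eig \<Omega> u v] by simp
  finally show ?thesis
    using 1 by simp
qed

lemma forward_dual_pairing:
  assumes eig: "dirichlet_eigensystem \<Omega> ev e" and dom: "bounded_domain \<Omega>"
    and u: "forward_solution a b \<Omega> T g f u0 u" and v: "dual_solution a b \<Omega> S \<phi> v"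
    and S: "0 \<le> S" "S \<le> T" and f: "f \<in> L2_space \<Omega>" and u0: "u0 \<in> L2_space \<Omega>" and \<phi>: "\<phi> \<in> L2_space \<Omega>"
    and g: "continuous_on UNIV g"
  shows "(\<integral>x. u S x * \<phi> x \<partial>lebesgue_on \<Omega>) - (\<integral>x. u0 x * v 0 x \<partial>lebesgue_on \<Omega>) =
    (\<integral>x. (\<integral>t. v t x * (g t * f x) \<partial>lebesgue_on {0<..<S}) \<partial>lebesgue_on \<Omega>)"
proof -
  have \<Omega>: "\<Omega> \<in> lmeasurable"
    using dom by (simp add: bounded_domain_def lmeasurable_open)
  then have \<Omega>': "\<Omega> \<in> sets lebesgue"
    by (rule fmeasurableD)
  have us: "u \<in> solution_space T \<Omega>" and vs: "v \<in> solution_space S \<Omega>"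
    using u v by (auto simp: forward_solution_def dual_solution_def)
  note uD = solution_spaceD[OF us] and vD = solution_spaceD[OF vs]
  note cu = continuous_into_L2_subset[OF uD(2) S(2)]
  have sub: "{0<..<S} \<subseteq> {0<..<T}"
    using S by auto
  have uL2: "u t \<in> L2_space \<Omega>" and vL2: "v t \<in> L2_space \<Omega>" if "t \<in> {0..S}" for t
    using cu vD(2) that by (auto simp: continuous_into_L2_def)
  have fams: "L2_family S \<Omega> u" "L2_family S \<Omega> v" "L2_family S \<Omega> (time_deriv T \<Omega> u)" "L2_family S \<Omega> (time_deriv S \<Omega> v)"
    by (rule L2_family_restrict[OF uD(3) S(2)] vD(3) L2_family_restrict[OF uD(4) S(2)] vD(4))+
  \<comment> \<open>Initial and final data are attained only almost everywhere in space, which the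
    pairing does not see.\<close>
  have "(\<integral>x. u S x * \<phi> x \<partial>lebesgue_on \<Omega>) = (\<integral>x. u S x * v S x \<partial>lebesgue_on \<Omega>)"
    using v S uL2[of S] vL2[of S] \<phi> by (intro L2_pairing_cong_AE) (auto simp: dual_solution_def elim: eventually_mono)
  moreover have "(\<integral>x. u0 x * v 0 x \<partial>lebesgue_on \<Omega>) = (\<integral>x. u 0 x * v 0 x \<partial>lebesgue_on \<Omega>)"
    using u S uL2[of 0] vL2[of 0] u0 by (intro L2_pairing_cong_AE) (auto simp: forward_solution_def elim: eventually_mono)
  ultimately have "(\<integral>x. u S x * \<phi> x \<partial>lebesgue_on \<Omega>) - (\<integral>x. u0 x * v 0 x \<partial>lebesgue_on \<Omega>) =
      (\<integral>x. u S x * v S x \<partial>lebesgue_on \<Omega>) - (\<integral>x. u 0 x * v 0 x \<partial>lebesgue_on \<Omega>)"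
    by simp
  also have "\<dots> = (\<integral>r. (\<integral>x. time_deriv T \<Omega> u r x * v r x \<partial>lebesgue_on \<Omega>) +
      (\<integral>x. u r x * time_deriv S \<Omega> v r x \<partial>lebesgue_on \<Omega>) \<partial>lebesgue_on {0<..<S})"
  proof (rule pairing_product_rule[OF \<Omega> S(1) cu vD(2) fams])
    fix p s t
    assume p: "p \<in> L2_space \<Omega>" and st: "0 \<le> s" "s \<le> t" "t \<le> S"
    show "(\<integral>x. u t x * p x \<partial>lebesgue_on \<Omega>) - (\<integral>x. u s x * p x \<partial>lebesgue_on \<Omega>) =
        cut_integral (lebesgue_on {0<..<S}) s t (\<lambda>r. \<integral>x. time_deriv T \<Omega> u r x * p x \<partial>lebesgue_on \<Omega>)"
      \<comment> \<open>Here the derivative refers to (0,T) and is cut down to (0,S); the one of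
        \<open>v\<close> below already lives on (0,S).\<close>
      by (rule time_deriv_pairing[OF uD(1,2) \<Omega> p st S(2)])
    show "(\<integral>x. v t x * p x \<partial>lebesgue_on \<Omega>) - (\<integral>x. v s x * p x \<partial>lebesgue_on \<Omega>) =
        cut_integral (lebesgue_on {0<..<S}) s t (\<lambda>r. \<integral>x. time_deriv S \<Omega> v r x * p x \<partial>lebesgue_on \<Omega>)"
      by (rule time_deriv_pairing[OF vD(1,2) \<Omega> p st order_refl])
  qed
  also have "\<dots> = (\<integral>r. (\<integral>x. v r x * (g r * f x) \<partial>lebesgue_on \<Omega>) \<partial>lebesgue_on {0<..<S})"
  proof (rule integral_cong_AE)
    have "AE t in lebesgue_on {0<..<S}. u t \<in> H10_space \<Omega> \<inter> H2_space \<Omega>"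
      by (rule AE_lebesgue_on_subset[OF uD(5) sub]) simp_all
    moreover have "AE t in lebesgue_on {0<..<S}. AE x in lebesgue_on \<Omega>.
        time_deriv T \<Omega> u t x - (of_real a + \<i> * of_real b) * laplacian \<Omega> (u t) x = g t * f x"
      by (rule AE_lebesgue_on_subset[OF _ sub]) (use u in \<open>simp_all add: forward_solution_def\<close>)
    moreover have "AE t in lebesgue_on {0<..<S}. AE x in lebesgue_on \<Omega>.
        time_deriv S \<Omega> v t x + (of_real a + \<i> * of_real b) * laplacian \<Omega> (v t) x = 0"
      using v by (simp add: dual_solution_def)
    moreover have "AE t in lebesgue_on {0<..<S}. time_deriv T \<Omega> u t \<in> L2_space \<Omega>"
      "AE t in lebesgue_on {0<..<S}. time_deriv S \<Omega> v t \<in> L2_space \<Omega>"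
      using fams(3,4) by (simp_all add: L2_family_def)
    ultimately show "AE r in lebesgue_on {0<..<S}. (\<integral>x. time_deriv T \<Omega> u r x * v r x \<partial>lebesgue_on \<Omega>) +
        (\<integral>x. u r x * time_deriv S \<Omega> v r x \<partial>lebesgue_on \<Omega>) = (\<integral>x. v r x * (g r * f x) \<partial>lebesgue_on \<Omega>)"
      using vD(5)
    proof eventually_elim
      case (elim r)
      show ?case
        by (rule forward_dual_pairing_derivative[OF eig \<Omega>' elim(1,6,4,5) f elim(2,3)])
    qed
    show "(\<lambda>r. (\<integral>x. time_deriv T \<Omega> u r x * v r x \<partial>lebesgue_on \<Omega>) +
        (\<integral>x. u r x * time_deriv S \<Omega> v r x \<partial>lebesgue_on \<Omega>)) \<in> borel_measurable (lebesgue_on {0<..<S})"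
      by (intro borel_measurable_integrable Bochner_Integration.integrable_add L2_family_pairing_integrable fams \<Omega>)
    show "(\<lambda>r. \<integral>x. v r x * (g r * f x) \<partial>lebesgue_on \<Omega>) \<in> borel_measurable (lebesgue_on {0<..<S})"
      by (intro borel_measurable_integrable L2_family_pairing_integrable fams \<Omega> L2_family_separated g f)
  qed
  also have "\<dots> = (\<integral>x. (\<integral>t. v t x * (g t * f x) \<partial>lebesgue_on {0<..<S}) \<partial>lebesgue_on \<Omega>)"
    by (rule L2_family_Fubini[OF fams(2) L2_family_separated[OF g f] \<Omega>, symmetric])
  finally show ?thesis .
qed

text \<open>The inner time integral is additive only at points \<open>x\<close> where both
  integrands are integrable. Subtracting on the product measure avoids following that exceptional
  set.\<close>

lemma integral_source_dual_diff:
  assumes \<Omega>: "\<Omega> \<in> lmeasurable" and v: "L2_family S \<Omega> v" and g: "continuous_on UNIV g"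
    and f: "f1 \<in> L2_space \<Omega>" "f2 \<in> L2_space \<Omega>"
  shows "(\<integral>x. (\<integral>t. v t x * (g t * (f1 x - f2 x)) \<partial>lebesgue_on {0<..<S}) \<partial>lebesgue_on \<Omega>) =
    (\<integral>x. (\<integral>t. v t x * (g t * f1 x) \<partial>lebesgue_on {0<..<S}) \<partial>lebesgue_on \<Omega>) -
    (\<integral>x. (\<integral>t. v t x * (g t * f2 x) \<partial>lebesgue_on {0<..<S}) \<partial>lebesgue_on \<Omega>)"
proof -
  interpret pair_sigma_finite "lebesgue_on {0<..<S}" "lebesgue_on \<Omega>"
    by (rule pair_sigma_finite_time_space[OF \<Omega>])
  have int: "integrable (lebesgue_on {0<..<S} \<Otimes>\<^sub>M lebesgue_on \<Omega>) (\<lambda>(t, x). v t x * (g t * f x))"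
    if "f \<in> L2_space \<Omega>" for f
    by (rule L2_family_mult_integrable[OF v L2_family_separated[OF g that] \<Omega>])
  have eq: "(\<integral>x. (\<integral>t. v t x * (g t * f x) \<partial>lebesgue_on {0<..<S}) \<partial>lebesgue_on \<Omega>) =
      (\<integral>z. (case z of (t, x) \<Rightarrow> v t x * (g t * f x)) \<partial>(lebesgue_on {0<..<S} \<Otimes>\<^sub>M lebesgue_on \<Omega>))"
    if "f \<in> L2_space \<Omega>" for f
    using integral_snd[OF int[OF that]] .
  show ?thesis
    unfolding eq[OF f(1)] eq[OF f(2)] eq[OF L2_space_diff[OF f]]
    by (subst Bochner_Integration.integral_diff[symmetric, OF int[OF f(1)] int[OF f(2)]])
      (simp add: case_prod_beta' algebra_simps)
qed

theorem theorem3: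
  fixes a b T :: real and \<gamma> :: complex
    and \<tau> :: "nat \<Rightarrow> real"
    and \<Omega> \<Omega>0 :: "'a::euclidean_space set"
    and ev :: "nat \<Rightarrow> real" and e :: "nat \<Rightarrow> 'a \<Rightarrow> complex"
    and g :: "real \<Rightarrow> complex"
    and u0 :: "'a \<Rightarrow> complex" and f :: "nat \<Rightarrow> 'a \<Rightarrow> complex"
    and u :: "nat \<Rightarrow> real \<Rightarrow> 'a \<Rightarrow> complex"
  assumes "a > 0" and "b \<noteq> 0"
    and "bounded_domain \<Omega>" and "analytic_hypersurface (frontier \<Omega>)"
    and "dirichlet_eigensystem \<Omega> ev e"
    and "0 < \<tau> 1" and "\<tau> 1 < \<tau> 2" and "\<tau> 2 \<le> T"
    and "subdomain \<Omega>0 \<Omega>"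
    and "u0 \<in> H10_space \<Omega> \<inter> H2_space \<Omega>"
    and "\<gamma> \<notin> (\<Union>n\<in>{1..}. {of_real (a * ev n) + \<i> * of_real (b * ev n)})"
    and "g = (\<lambda>t. exp (- \<gamma> * of_real t))"
    and "\<And>j. j \<in> {1..2} \<Longrightarrow> f j \<in> L2_space \<Omega>"
    and "\<And>j. j \<in> {1..2} \<Longrightarrow> forward_solution a b \<Omega> T g (f j) u0 (u j)"
  shows "B_norm a b g \<Omega> \<Omega>0 \<tau> (\<lambda>x. f 1 x - f 2 x)
           \<le> ennreal (\<Sum>j=1..2. L2_norm \<Omega>0 (\<lambda>x. u 1 (\<tau> j) x - u 2 (\<tau> j) x))"
proof -
  have \<Omega>: "\<Omega> \<in> lmeasurable" "\<Omega> \<in> sets lebesgue"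
    using \<open>bounded_domain \<Omega>\<close> by (simp_all add: bounded_domain_def lmeasurable_open)
  have \<Omega>0: "\<Omega>0 \<in> sets lebesgue" "\<Omega>0 \<subseteq> \<Omega>"
    using \<open>subdomain \<Omega>0 \<Omega>\<close> by (simp_all add: subdomain_def)
  have g: "continuous_on UNIV g"
    unfolding \<open>g = _\<close> by (intro continuous_intros)
  have u0: "u0 \<in> L2_space \<Omega>"
    using \<open>u0 \<in> _\<close> by (simp add: H10_space_def H1_space_def)
  \<comment> \<open>Each observation time is estimated on its own, with its own dual solution; the
    sum over \<open>j\<close> is then bounded termwise.\<close>
  have bound: "cmod (\<integral>x. (\<integral>t. g t * v t x * (f 1 x - f 2 x) \<partial>lebesgue_on {0<..<\<tau> j}) \<partial>lebesgue_on \<Omega>)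
      \<le> L2_norm \<Omega>0 (\<lambda>x. u 1 (\<tau> j) x - u 2 (\<tau> j) x)"
    if j: "j \<in> {1..2}" and \<phi>: "\<phi> \<in> test_functions \<Omega>0" and norm_\<phi>: "L2_norm \<Omega>0 \<phi> = 1"
      and v: "dual_solution a b \<Omega> (\<tau> j) \<phi> v" for j \<phi> v
  proof -
    have \<tau>: "0 \<le> \<tau> j" "\<tau> j \<le> T"
    proof -
      have "j = 1 \<or> j = 2"
        using j by auto
      then show "0 \<le> \<tau> j" "\<tau> j \<le> T"
        using assms(6-8) by auto
    qed
    have \<phi>0: "\<phi> \<in> L2_space \<Omega>0"
      by (rule test_functions_subset_L2[OF \<phi> \<Omega>0(1)])
    have "\<phi> \<in> test_functions \<Omega>"
      using \<phi> \<Omega>0(2) by (auto simp: test_functions_def)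
    then have \<phi>L2: "\<phi> \<in> L2_space \<Omega>"
      using \<Omega>(2) by (rule test_functions_subset_L2)
    have uL2: "u k (\<tau> j) \<in> L2_space \<Omega>" if "k \<in> {1..2}" for k
      using assms(14)[OF that] \<tau> by (auto simp: forward_solution_def solution_space_def continuous_into_L2_def)
    have pair: "(\<integral>x. u k (\<tau> j) x * \<phi> x \<partial>lebesgue_on \<Omega>) - (\<integral>x. u0 x * v 0 x \<partial>lebesgue_on \<Omega>) =
        (\<integral>x. (\<integral>t. v t x * (g t * f k x) \<partial>lebesgue_on {0<..<\<tau> j}) \<partial>lebesgue_on \<Omega>)" if "k \<in> {1..2}" for k
      by (rule forward_dual_pairing[OF assms(5,3) assms(14)[OF that] v \<tau> assms(13)[OF that] u0 \<phi>L2 g])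
    have vf: "L2_family (\<tau> j) \<Omega> v"
      using v by (intro solution_spaceD) (simp add: dual_solution_def)
    have "(\<integral>x. (\<integral>t. g t * v t x * (f 1 x - f 2 x) \<partial>lebesgue_on {0<..<\<tau> j}) \<partial>lebesgue_on \<Omega>) =
        (\<integral>x. (\<integral>t. v t x * (g t * (f 1 x - f 2 x)) \<partial>lebesgue_on {0<..<\<tau> j}) \<partial>lebesgue_on \<Omega>)"
      by (simp only: ac_simps)
    also have "\<dots> = (\<integral>x. (\<integral>t. v t x * (g t * f 1 x) \<partial>lebesgue_on {0<..<\<tau> j}) \<partial>lebesgue_on \<Omega>) -
        (\<integral>x. (\<integral>t. v t x * (g t * f 2 x) \<partial>lebesgue_on {0<..<\<tau> j}) \<partial>lebesgue_on \<Omega>)"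
      by (rule integral_source_dual_diff[OF \<Omega>(1) vf g assms(13) assms(13)]) simp_all
    also have "\<dots> = (\<integral>x. u 1 (\<tau> j) x * \<phi> x \<partial>lebesgue_on \<Omega>) - (\<integral>x. u 2 (\<tau> j) x * \<phi> x \<partial>lebesgue_on \<Omega>)"
      using pair[of 1, symmetric] pair[of 2, symmetric] by simp
    also have "\<dots> = (\<integral>x. (u 1 (\<tau> j) x - u 2 (\<tau> j) x) * \<phi> x \<partial>lebesgue_on \<Omega>)"
      by (rule L2_pairing_diff_left[symmetric]) (use uL2 \<phi>L2 in auto)
    \<comment> \<open>The final datum \<phi> vanishes outside \<Omega>0, so the pairing sees the
      solutions only where they are observed.\<close>
    also have "\<dots> = (\<integral>x. (u 1 (\<tau> j) x - u 2 (\<tau> j) x) * \<phi> x \<partial>lebesgue_on \<Omega>0)"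
    proof -
      have z: "(u 1 (\<tau> j) x - u 2 (\<tau> j) x) * \<phi> x = 0" if "x \<notin> \<Omega>0" for x
        using test_functionsD(4)[OF \<phi> that] by simp
      have z': "(u 1 (\<tau> j) x - u 2 (\<tau> j) x) * \<phi> x = 0" if "x \<notin> \<Omega>" for x
        using z \<Omega>0(2) that by blast
      show ?thesis
        using integral_restrict_support[OF \<Omega>(2) z'] integral_restrict_support[OF \<Omega>0(1) z] by simp
    qed
    also have "cmod \<dots> \<le> L2_norm \<Omega>0 (\<lambda>x. u 1 (\<tau> j) x - u 2 (\<tau> j) x) * L2_norm \<Omega>0 \<phi>"
      by (intro L2_Cauchy_Schwarz \<phi>0 L2_space_subset[OF L2_space_diff \<Omega>0(2,1) \<Omega>(2)] uL2) simp_all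
    finally show ?thesis
      by (simp add: norm_\<phi>)
  qed
  show ?thesis
    unfolding B_norm_def
  proof (rule SUP_least, clarify)
    fix \<phi> v
    assume adm: "\<forall>j\<in>{1..2}. \<phi> j \<in> test_functions \<Omega>0 \<and> L2_norm \<Omega>0 (\<phi> j) = 1 \<and> dual_solution a b \<Omega> (\<tau> j) (\<phi> j) (v j)"
    show "ennreal (\<Sum>j=1..2. cmod (\<integral>x. (\<integral>t. g t * v j t x * (f 1 x - f 2 x) \<partial>lebesgue_on {0<..<\<tau> j}) \<partial>lebesgue_on \<Omega>))
        \<le> ennreal (\<Sum>j=1..2. L2_norm \<Omega>0 (\<lambda>x. u 1 (\<tau> j) x - u 2 (\<tau> j) x))"
      using adm by (intro ennreal_leI sum_mono bound) blast+
  qed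
qed

end
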